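(* The Frantzikinakis–Host conjecture is true in the class of pretentious functions: every real-valued pretentious $f\in\mathcal{M}$ has a unique Furstenberg system, i.e. $f$ is a generic point.
   Context: $\mathcal{M}$ is the class of multiplicative functions $f:\mathbb{N}\to\mathbb{C}$ ($f(mn)=f(m)f(n)$ for coprime $m,n$) with $|f|\le1$. $f\in\mathcal{M}$ is pretentious if there are a Dirichlet character $\chi$ and $t\in\mathbb{R}$ with $\sum_{p\text{ prime}}\frac1p\big(1-\mathrm{Re}(f(p)\overline{\chi(p)p^{it}})\big)<+\infty$. Furstenberg systems: let $\mathbb{U}$ be the closed unit disc and $S$ the left shift on $\mathbb{U}^{\mathbb{Z}}$; view $f$ as an element of $\mathbb{U}^{\mathbb{Z}}$ (extended e.g. by $0$ to non-positive integers) and let $X_f=\overline{\{S^nf:n\in\mathbb{Z}\}}$. A Furstenberg system of $f$ is any system $(X_f,\nu,S)$ with $\nu$ a weak$^*$ limit $\lim_{k\to\infty}\frac1{N_k}\sum_{n\le N_k}\delta_{S^nf}$ for some $N_k\to\infty$. $f$ has a unique Furstenberg system ($f$ is generic) if $\lim_{N\to\infty}\frac1N\sum_{n\le N}\delta_{S^nf}$ exists in the weak$^*$ topology. *)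

theory Defs
  imports "HOL-Probability.Probability" "HOL-Computational_Algebra.Primes"
begin

text \<open>
  The positive integers carry the arithmetic functions: values at \<open>0\<close> are never constrained or used.
\<close>

definition multiplicative_unit_class :: "(nat \<Rightarrow> complex) set" where
  "multiplicative_unit_class =
     {f. (\<forall>m>0. \<forall>n>0. coprime m n \<longrightarrow> f (m * n) = f m * f n) \<and> (\<forall>n>0. norm (f n) \<le> 1)}"

definition dirichlet_character :: "nat \<Rightarrow> (nat \<Rightarrow> complex) \<Rightarrow> bool" where
  "dirichlet_character q chi \<longleftrightarrow>
     q > 0 \<and> (\<forall>n. chi (n + q) = chi n) \<and> (\<forall>m n. chi (m * n) = chi m * chi n) \<and>
     (\<forall>n. chi n \<noteq> 0 \<longleftrightarrow> coprime n q)"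

text \<open>
  For \<open>f\<close> bounded by \<open>1\<close> all terms of the series are nonnegative, so summability over the set of
  primes says exactly that the series is finite.
\<close>

definition pretentious :: "(nat \<Rightarrow> complex) \<Rightarrow> bool" where
  "pretentious f \<longleftrightarrow>
     (\<exists>q chi. \<exists>t::real. dirichlet_character q chi \<and>
        (\<lambda>p. 1 / real p * (1 - Re (f p * cnj (chi p * of_nat p powr (\<i> * of_real t)))))
          summable_on {p. prime p})"

definition extend_by_zero :: "(nat \<Rightarrow> complex) \<Rightarrow> int \<Rightarrow> complex" where
  "extend_by_zero f n = (if n > 0 then f (nat n) else 0)"

definition left_shift :: "(int \<Rightarrow> 'a) \<Rightarrow> int \<Rightarrow> 'a" where
  "left_shift x = (\<lambda>m. x (m + 1))"

text \<open>The integer powers of the invertible map \<^term>\<open>left_shift\<close>; see the lemmas below.\<close>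

definition shift_pow :: "int \<Rightarrow> (int \<Rightarrow> 'a) \<Rightarrow> int \<Rightarrow> 'a" where
  "shift_pow n x = (\<lambda>m. x (m + n))"

lemma shift_pow_nat: "shift_pow (int n) x = (left_shift ^^ n) x"
proof (induction n)
  case (Suc n)
  have "(left_shift ^^ Suc n) x = left_shift (shift_pow (int n) x)"
    by (simp add: Suc)
  also have "\<dots> = shift_pow (int (Suc n)) x"
    by (simp add: shift_pow_def left_shift_def add_ac)
  finally show ?case ..
qed (simp add: shift_pow_def)

lemma shift_pow_add: "shift_pow (m + n) x = shift_pow m (shift_pow n x)"
  by (simp add: shift_pow_def add_ac)

lemma shift_pow_0: "shift_pow 0 x = x"
  by (simp add: shift_pow_def)

text \<open>
  The type \<^typ>\<open>int \<Rightarrow> complex\<close> carries the product topology.  The sequences with values in the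
  closed unit disc form a closed (and compact) subset, so for \<open>f\<close> bounded by \<open>1\<close> the closure below
  coincides with the closure inside the space of disc-valued sequences.
\<close>

definition orbit_closure :: "(nat \<Rightarrow> complex) \<Rightarrow> (int \<Rightarrow> complex) set" where
  "orbit_closure f = closure (range (\<lambda>n. shift_pow n (extend_by_zero f)))"

lemma orbit_closure_disc:
  assumes "f \<in> multiplicative_unit_class"
  shows "orbit_closure f \<subseteq> {x. \<forall>n. x n \<in> cball 0 1}"
proof -
  have "closed {x :: int \<Rightarrow> complex. \<forall>n. x n \<in> cball 0 1}"
    by (intro closed_Collect_all closed_Collect_le continuous_intros
        continuous_on_product_coordinates | simp add: dist_norm)+
  moreover have "shift_pow n (extend_by_zero f) m \<in> cball 0 1" for n m
    using assms by (auto simp: shift_pow_def extend_by_zero_def multiplicative_unit_class_def)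
  ultimately show ?thesis
    unfolding orbit_closure_def by (intro closure_minimal) auto
qed

definition prob_measures_on :: "'a::topological_space set \<Rightarrow> 'a measure set" where
  "prob_measures_on X = {\<nu>. prob_space \<nu> \<and> sets \<nu> = sets (restrict_space borel X)}"

text \<open>
  \<open>(1/N) \<Sum>\<^sub>n\<^sub>\<le>\<^sub>N \<delta>\<^bsub>S\<^sup>n f\<^esub>\<close> as the law of \<open>S\<^sup>n f\<close> for \<open>n\<close> uniform in \<open>{1..N}\<close>; for \<open>N = 0\<close> it is the
  null measure.
\<close>

definition empirical_measure :: "(nat \<Rightarrow> complex) \<Rightarrow> nat \<Rightarrow> (int \<Rightarrow> complex) measure" where
  "empirical_measure f N =
     distr (uniform_count_measure {1..N}) (restrict_space borel (orbit_closure f))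
       (\<lambda>n. shift_pow (int n) (extend_by_zero f))"

text \<open>
  Sequential convergence in the weak* topology on the finite measures on a compact space \<open>X\<close>,
  viewed as functionals on the complex-valued continuous functions on \<open>X\<close>.
\<close>

definition weak_star_tendsto ::
    "'a::topological_space set \<Rightarrow> (nat \<Rightarrow> 'a measure) \<Rightarrow> 'a measure \<Rightarrow> bool" where
  "weak_star_tendsto X M \<nu> \<longleftrightarrow>
     (\<forall>g :: 'a \<Rightarrow> complex. continuous_on X g \<longrightarrow>
        (\<lambda>k. \<integral>x. g x \<partial>M k) \<longlonglongrightarrow> (\<integral>x. g x \<partial>\<nu>))"

text \<open>
  The space and the map of a Furstenberg system are determined by \<open>f\<close>, so the system is identified
  with its measure.
\<close>

definition furstenberg_system :: "(nat \<Rightarrow> complex) \<Rightarrow> (int \<Rightarrow> complex) measure \<Rightarrow> bool" where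
  "furstenberg_system f \<nu> \<longleftrightarrow>
     \<nu> \<in> prob_measures_on (orbit_closure f) \<and>
     (\<exists>N :: nat \<Rightarrow> nat. filterlim N at_top sequentially \<and>
        weak_star_tendsto (orbit_closure f) (\<lambda>k. empirical_measure f (N k)) \<nu>)"

definition generic_point :: "(nat \<Rightarrow> complex) \<Rightarrow> bool" where
  "generic_point f \<longleftrightarrow>
     (\<exists>\<nu> \<in> prob_measures_on (orbit_closure f).
        weak_star_tendsto (orbit_closure f) (empirical_measure f) \<nu>)"

lemma integral_empirical_measure:
  fixes g :: "(int \<Rightarrow> complex) \<Rightarrow> complex"
  assumes "continuous_on (orbit_closure f) g"
  shows "(\<integral>x. g x \<partial>empirical_measure f N) =
           (\<Sum>n=1..N. g (shift_pow (int n) (extend_by_zero f))) / of_nat N"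
proof -
  have mem: "shift_pow n (extend_by_zero f) \<in> orbit_closure f" for n
    unfolding orbit_closure_def using closure_subset by fastforce
  have meas: "(\<lambda>n. shift_pow (int n) (extend_by_zero f)) \<in>
      uniform_count_measure {1..N} \<rightarrow>\<^sub>M restrict_space borel (orbit_closure f)"
    using mem by (auto simp: measurable_def space_restrict_space sets_uniform_count_measure
        space_uniform_count_measure)
  have "(\<integral>x. g x \<partial>empirical_measure f N) =
      (\<integral>n. g (shift_pow (int n) (extend_by_zero f)) \<partial>uniform_count_measure {1..N})"
    unfolding empirical_measure_def
    by (rule integral_distr[OF meas borel_measurable_continuous_on_restrict[OF assms]])
  also have "\<dots> = (\<Sum>n=1..N. g (shift_pow (int n) (extend_by_zero f))) / of_nat N"
    unfolding uniform_count_measure_def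
    by (subst lebesgue_integral_point_measure_finite)
       (auto simp: scaleR_conv_of_real sum_divide_distrib)
  finally show ?thesis .
qed

end

theory Submission
  imports Defs "HOL-Number_Theory.Residues"
begin

text \<open>
  Let \<open>f\<close> be real-valued and pretend to be \<open>\<chi>(n) n\<^sup>i\<^sup>t\<close>. Since \<open>f(p)\<close> is real, \<open>\<chi>(p) p\<^sup>i\<^sup>t\<close> is close to
  \<open>\<plusminus>1\<close> for most primes; raising it to the power \<open>2 \<phi>(q)\<close> shows that \<open>p\<^sup>i\<^sup>v\<close> with \<open>v = 2 \<phi>(q) t\<close> pretends
  to be \<open>1\<close>, and comparing Euler products this would bound \<open>|\<zeta>(\<sigma>)|\<close> by a multiple of
  \<open>|\<zeta>(\<sigma> + i v)|\<close> as \<open>\<sigma> \<rightarrow> 1\<close>, which the pole of \<open>\<zeta>\<close> forbids unless \<open>t = 0\<close>. Reality then also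
  upgrades the hypothesis to the absolute convergence of \<open>\<Sum>\<^sub>p |f(p) - \<chi>(p)| / p\<close>, so that replacing
  \<open>f\<close> by \<open>\<chi>\<close> at all large primes changes \<open>f\<close> little in mean: \<open>f\<close> is a limit of periodic sequences
  in the Besicovitch seminorm.

  The Furstenberg system of such a sequence is a factor of an odometer. Its measure is constructed
  without the Riesz representation theorem, as the law of an almost sure limit of the periodic
  approximants read along a Haar-random point of the odometer.
\<close>

section \<open>The zeta function near its pole\<close>

text \<open>Reality is essential for the conclusion: the means of \<open>n^(it)\<close> behave like
  \<open>N^(it) / (1 + it)\<close> and diverge for nonzero t. In the exponent 2 \<phi>(q), the
  factor \<phi>(q) removes the character by Euler's theorem and the factor 2 removes the sign.

  Reality enters a second time. In general 1 - Re(f(p) cnj(chi(p))) controls only a square of the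
  distance, whereas approximation in mean by periodic sequences costs its first power. For real f(p)
  the deficit is linear in the distance when chi(p) is 1 or -1, and bounded below when chi(p) is
  nonreal.

  The measure has to come from somewhere: convergence of orbit averages yields only a functional.
  All periodic approximants are therefore put on one probability space and read at the same random
  point, so that the expected distance of two consecutive ones is an average over a full period. A
  point of the odometer is a sequence of digits, and one uniform number in [0, 1) supplies all of
  them.\<close>

lemma powr_variation_le:
  fixes s :: complex and a :: real
  assumes "Re s \<ge> 1" "a \<ge> 1" "w \<in> closed_segment (of_real a) (of_real (a + 1))"
  shows "norm (w powr (-s) - of_real a powr (-s)) \<le> norm s / a\<^sup>2"
proof -
  let ?S = "closed_segment (of_real a :: complex) (of_real (a + 1))"
  have real: "\<exists>x. z = of_real x \<and> a \<le> x \<and> x \<le> a + 1" if "z \<in> ?S" for z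
  proof -
    have "z \<in> of_real ` closed_segment a (a + 1)"
      using that by (simp flip: closed_segment_of_real)
    then show ?thesis by (auto simp: closed_segment_eq_real_ivl)
  qed
  have "norm (w powr (-s) - of_real a powr (-s)) \<le> (norm s / a\<^sup>2) * norm (w - of_real a)"
  proof (rule field_differentiable_bound[where S = ?S and f' = "\<lambda>z. -s * z powr (-s - 1)"])
    fix z assume "z \<in> ?S"
    then obtain x where x: "z = of_real x" "a \<le> x" using real by blast
    have "z \<notin> \<real>\<^sub>\<le>\<^sub>0" using x assms by (auto simp: complex_nonpos_Reals_iff)
    then show "((\<lambda>z. z powr (-s)) has_field_derivative -s * z powr (-s - 1)) (at z within ?S)"
      by (intro has_field_derivative_at_within[OF has_field_derivative_powr])
    have "norm (z powr (-s - 1)) = x powr (- Re s - 1)"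
      using x assms by (simp add: norm_powr_real_powr)
    also have "\<dots> \<le> x powr (-2)" using x assms by (intro powr_mono) auto
    also have "\<dots> = 1 / x\<^sup>2" using x assms by (simp add: powr_minus divide_inverse)
    also have "\<dots> \<le> 1 / a\<^sup>2" using x assms by (intro divide_left_mono power_mono) auto
    finally show "norm (-s * z powr (-s - 1)) \<le> norm s / a\<^sup>2"
      by (simp add: norm_mult mult_left_mono divide_inverse)
  qed (use assms in auto)
  also have "norm (w - of_real a) \<le> 1"
    using real[OF assms(3)] by (metis (no_types, lifting) abs_of_nonneg add_diff_cancel_left'
        diff_ge_0_iff_ge diff_right_mono norm_of_real of_real_diff)
  then have "(norm s / a\<^sup>2) * norm (w - of_real a) \<le> norm s / a\<^sup>2"
    by (intro mult_left_le) auto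
  finally show ?thesis .
qed

text \<open>The quotient is the integral of x^(-s) over [a, a + 1]. The auxiliary \<open>H\<close>
  is an antiderivative of z^(-s) - a^(-s), so the bound on this variation and the mean value
  inequality replace any integration.\<close>

lemma powr_integral_comparison:
  fixes s :: complex and a :: real
  assumes "Re s \<ge> 1" "s \<noteq> 1" "a \<ge> 1"
  shows "norm (of_real a powr (-s) -
           (of_real a powr (1 - s) - of_real (a + 1) powr (1 - s)) / (s - 1)) \<le> norm s / a\<^sup>2"
proof -
  let ?S = "closed_segment (of_real a :: complex) (of_real (a + 1))"
  define H where "H z = z powr (1 - s) / (1 - s) - of_real a powr (-s) * z" for z
  have "norm (H (of_real (a + 1)) - H (of_real a)) \<le>
      (norm s / a\<^sup>2) * norm (of_real (a + 1) - of_real a :: complex)"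
  proof (rule field_differentiable_bound[where S = ?S and
        f' = "\<lambda>z. z powr (-s) - of_real a powr (-s)"])
    fix z assume z: "z \<in> ?S"
    then have "z \<in> of_real ` closed_segment a (a + 1)"
      by (simp flip: closed_segment_of_real)
    then have "z \<notin> \<real>\<^sub>\<le>\<^sub>0"
      using assms by (auto simp: complex_nonpos_Reals_iff closed_segment_eq_real_ivl)
    then show "(H has_field_derivative z powr (-s) - of_real a powr (-s)) (at z within ?S)"
      unfolding H_def using assms
      by (auto intro!: derivative_eq_intros has_field_derivative_at_within[OF has_field_derivative_powr])
    show "norm (z powr (-s) - of_real a powr (-s)) \<le> norm s / a\<^sup>2"
      using powr_variation_le[OF assms(1,3) z] .
  qed auto
  also have "H (of_real (a + 1)) - H (of_real a) =
      -(of_real a powr (-s) - (of_real a powr (1 - s) - of_real (a + 1) powr (1 - s)) / (s - 1))"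
  proof -
    have "1 - s \<noteq> 0" "s - 1 \<noteq> 0" using assms(2) by auto
    moreover have "x / (1 - s) = - (x / (s - 1))" for x :: complex
      by (metis minus_diff_eq minus_divide_right)
    ultimately show ?thesis by (simp add: H_def algebra_simps diff_divide_distrib)
  qed
  finally show ?thesis by (simp only: norm_minus_cancel) simp
qed

lemma
  fixes s :: complex
  assumes "Re s > 1"
  shows summable_on_nat_powr: "(\<lambda>n::nat. norm (of_nat n powr (-s))) summable_on A"
    and summable_on_nat_powr_real: "(\<lambda>n::nat. real n powr (- Re s)) summable_on A"
proof -
  have n: "norm (of_nat n powr (-s) :: complex) = real n powr (- Re s)" for n :: nat
    by (cases "n = 0") (auto simp: norm_powr_real_powr)
  have "summable (\<lambda>n. norm (of_nat n powr (-s) :: complex))"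
    unfolding n using assms by (subst summable_real_powr_iff) auto
  then have "(\<lambda>n::nat. norm (of_nat n powr (-s))) summable_on UNIV"
    by (subst summable_on_UNIV_nonneg_real_iff) auto
  then show "(\<lambda>n::nat. norm (of_nat n powr (-s))) summable_on A"
    using summable_on_subset_banach by blast
  then show "(\<lambda>n::nat. real n powr (- Re s)) summable_on A"
    unfolding n .
qed

text \<open>The index 0 is harmless, because \<open>0 powr (-s)\<close> is 0.\<close>

definition zeta_series :: "complex \<Rightarrow> complex" where
  "zeta_series s = (\<Sum>\<^sub>\<infinity>n. of_nat n powr (-s))"

text \<open>The integrals over [a, a + 1] telescope to 1 / (s - 1), and the errors |s| / a^2 have a
  bounded sum. One estimate thus serves for the blow-up at 1 and for boundedness near any other
  point of the line Re s = 1.\<close>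

lemma zeta_series_near_pole:
  assumes "Re s > 1"
  shows "norm (zeta_series s - 1 / (s - 1)) \<le> 2 * norm s"
proof -
  have s1: "s \<noteq> 1" using assms by auto
  define T where "T n = (of_nat n :: complex) powr (-s)" for n :: nat
  have "T summable_on UNIV"
    unfolding T_def by (rule Infinite_Sum.abs_summable_summable[OF summable_on_nat_powr[OF assms]])
  then have "T sums zeta_series s"
    unfolding zeta_series_def T_def[symmetric] by (intro has_sum_imp_sums has_sum_infsum)
  then have lim: "(\<lambda>N. \<Sum>n<Suc N. T n) \<longlonglongrightarrow> zeta_series s"
    unfolding sums_def by (rule LIMSEQ_Suc)
  \<comment> \<open>The factor 2 - 2 / (N + 1) is the telescoped form of 1 / a^2 \<le> 2 / a - 2 /
    (a + 1), summed over a from 1 to N.\<close>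
  have bound: "norm ((\<Sum>n<Suc N. T n) - (1 - of_nat (Suc N) powr (1 - s)) / (s - 1))
      \<le> norm s * (2 - 2 / (real N + 1))" for N
  proof (induction N)
    case 0 then show ?case by (simp add: T_def)
  next
    case (Suc N)
    let ?a = "real (Suc N)"
    have "(\<Sum>n<Suc (Suc N). T n) - (1 - of_nat (Suc (Suc N)) powr (1 - s)) / (s - 1) =
      ((\<Sum>n<Suc N. T n) - (1 - of_nat (Suc N) powr (1 - s)) / (s - 1)) +
      (of_real ?a powr (-s) - (of_real ?a powr (1 - s) - of_real (?a + 1) powr (1 - s)) / (s - 1))"
      using s1 by (simp add: T_def diff_divide_distrib add_ac)
    also have "norm \<dots> \<le> norm s * (2 - 2 / (real N + 1)) + norm s / ?a\<^sup>2"
      by (rule norm_triangle_le[OF add_mono[OF Suc powr_integral_comparison]]) (use assms s1 in auto)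
    also have "norm s / ?a\<^sup>2 \<le> norm s * (2 / (real N + 1) - 2 / (real N + 2))"
    proof -
      have "1 / ?a\<^sup>2 \<le> 2 / (real N + 1) - 2 / (real N + 2)"
      proof -
        have "2 / (2 * ?a\<^sup>2) \<le> 2 / ((real N + 1) * (real N + 2))"
          by (intro divide_left_mono mult_pos_pos zero_less_power) (auto simp: power2_eq_square algebra_simps)
        also have "\<dots> = 2 / (real N + 1) - 2 / (real N + 2)"
          by (simp add: field_simps)
        finally show ?thesis by simp
      qed
      from mult_left_mono[OF this norm_ge_zero[of s]] show ?thesis by simp
    qed
    finally show ?case by (simp add: algebra_simps)
  qed
  have "(\<lambda>N. real (Suc N) powr - (Re s - 1)) \<longlonglongrightarrow> 0"
    using assms by (intro LIMSEQ_Suc[of "\<lambda>n. real n powr - (Re s - 1)"] tendsto_neg_powr filterlim_real_sequentially) auto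
  then have "(\<lambda>N. of_nat (Suc N) powr (1 - s) :: complex) \<longlonglongrightarrow> 0"
    by (rule tendsto_norm_zero_cancel[OF iffD2[OF filterlim_cong, rotated 3]]) (auto simp: norm_powr_real_powr simp del: of_nat_Suc)
  note small = this
  have "(\<lambda>N. (\<Sum>n<Suc N. T n) - (1 - of_nat (Suc N) powr (1 - s)) / (s - 1))
      \<longlonglongrightarrow> zeta_series s - (1 - 0) / (s - 1)"
    by (intro tendsto_diff tendsto_divide lim tendsto_const small) (use s1 in simp)
  then have "norm (zeta_series s - (1 - 0) / (s - 1)) \<le> norm s * 2"
  proof (rule tendsto_upperbound[OF tendsto_norm])
    show "\<forall>\<^sub>F N in sequentially. norm ((\<Sum>n<Suc N. T n) - (1 - of_nat (Suc N) powr (1 - s)) / (s - 1)) \<le> norm s * 2"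
      using bound by (intro always_eventually allI order_trans[OF bound] mult_left_mono) auto
  qed simp
  then show ?thesis by simp
qed

section \<open>The Euler product by sieving\<close>

definition rough_numbers :: "nat \<Rightarrow> nat set" where
  "rough_numbers K = {n. n > 0 \<and> (\<forall>p. prime p \<and> p \<le> K \<longrightarrow> \<not> p dvd n)}"

text \<open>The multiples of p in \<open>A\<close> are exactly the products p m with m in
  \<open>A\<close>, so by complete multiplicativity of n^(-s) they carry the fraction p^(-s) of the
  whole sum.\<close>

lemma infsum_sieve_step:
  fixes s :: complex
  assumes "Re s > 1" "prime p" "\<And>m. p * m \<in> A \<longleftrightarrow> m \<in> A"
  shows "(\<Sum>\<^sub>\<infinity>n\<in>{n\<in>A. \<not> p dvd n}. of_nat n powr (-s)) =
     (1 - of_nat p powr (-s)) * (\<Sum>\<^sub>\<infinity>n\<in>A. of_nat n powr (-s) :: complex)"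
proof -
  have p: "p > 0" using assms(2) prime_gt_0_nat by blast
  let ?h = "\<lambda>n::nat. of_nat n powr (-s) :: complex"
  have sm: "?h summable_on B" for B
    by (rule Infinite_Sum.abs_summable_summable[OF summable_on_nat_powr[OF assms(1)]])
  have A: "A = {n\<in>A. \<not> p dvd n} \<union> (*) p ` A"
    using assms(3) by (auto elim!: dvdE)
  have "infsum ?h A = infsum ?h {n\<in>A. \<not> p dvd n} + infsum ?h ((*) p ` A)"
    by (subst A, rule infsum_Un_disjoint) (auto intro!: sm)
  also have "infsum ?h ((*) p ` A) = infsum (?h \<circ> (*) p) A"
    using p by (intro infsum_reindex inj_onI) auto
  also have "\<dots> = (\<Sum>\<^sub>\<infinity>n\<in>A. ?h p * ?h n)"
    by (intro infsum_cong) (simp add: powr_times_real)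
  also have "\<dots> = ?h p * infsum ?h A"
    by (rule infsum_cmult_right) (rule sm)
  finally show ?thesis by (simp add: algebra_simps)
qed

lemma infsum_rough_numbers:
  assumes "Re s > 1"
  shows "(\<Sum>\<^sub>\<infinity>n\<in>rough_numbers K. of_nat n powr (-s)) =
     (\<Prod>p | prime p \<and> p \<le> K. 1 - of_nat p powr (-s)) * zeta_series s"
proof (induction K)
  case 0
  have "{p::nat. prime p \<and> p \<le> 0} = {}" by auto
  moreover have "rough_numbers 0 = UNIV - {0}" by (auto simp: rough_numbers_def)
  moreover have "(\<Sum>\<^sub>\<infinity>n\<in>UNIV - {0}. of_nat n powr (-s) :: complex) = zeta_series s"
    unfolding zeta_series_def by (rule infsum_cong_neutral) auto
  ultimately show ?case by (simp add: zeta_series_def)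
next
  case (Suc K)
  show ?case
  proof (cases "prime (Suc K)")
    case True
    have "{p. prime p \<and> p \<le> Suc K} = insert (Suc K) {p. prime p \<and> p \<le> K}"
      using True le_Suc_eq by auto
    moreover have "rough_numbers (Suc K) = {n\<in>rough_numbers K. \<not> Suc K dvd n}"
      using True by (auto simp: rough_numbers_def le_Suc_eq)
    moreover have "Suc K * m \<in> rough_numbers K \<longleftrightarrow> m \<in> rough_numbers K" for m
    proof -
      have "\<not> p dvd Suc K" if "prime p" "p \<le> K" for p
        using that True by (metis Suc_n_not_le_n primes_dvd_imp_eq)
      then show ?thesis by (auto simp: rough_numbers_def prime_dvd_mult_iff simp del: mult_Suc)
    qed
    ultimately show ?thesis
      using infsum_sieve_step[OF assms True, of "rough_numbers K"] Suc by (simp add: mult.assoc)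
  next
    case False
    have "{p. prime p \<and> p \<le> Suc K} = {p. prime p \<and> p \<le> K}"
      using False le_Suc_eq by auto
    moreover have "rough_numbers (Suc K) = rough_numbers K"
      using False by (auto simp: rough_numbers_def le_Suc_eq)
    ultimately show ?thesis using Suc by simp
  qed
qed

text \<open>After sieving by the primes up to \<open>K\<close>, every remaining integer other than 1
  exceeds \<open>K\<close>, so the sum is 1 plus part of a convergent tail. Keeping zeta as a factor
  avoids infinite products.\<close>

lemma euler_product_tendsto:
  assumes "Re s > 1"
  shows "(\<lambda>K. (\<Prod>p | prime p \<and> p \<le> K. 1 - of_nat p powr (-s)) * zeta_series s) \<longlonglongrightarrow> 1"
proof -
  let ?h = "\<lambda>n::nat. of_nat n powr (-s) :: complex"
  let ?r = "\<lambda>n::nat. real n powr (- Re s)"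
  have sm: "(\<lambda>n. norm (?h n)) summable_on B" for B
    using summable_on_nat_powr[OF assms] by blast
  have smr: "?r summable_on B" for B
    using summable_on_nat_powr_real[OF assms] by blast
  have "norm (infsum ?h (rough_numbers K) - 1) \<le> (\<Sum>\<^sub>\<infinity>n. ?r n) - (\<Sum>n<Suc K. ?r n)" for K
  proof -
    have 1: "1 \<in> rough_numbers K" by (auto simp: rough_numbers_def dest: prime_gt_1_nat)
    have "rough_numbers K - {1} \<subseteq> {Suc K..}"
    proof
      fix n assume n: "n \<in> rough_numbers K - {1}"
      then obtain p where "prime p" "p dvd n" by (metis DiffD2 prime_factor_nat singletonI)
      then show "n \<in> {Suc K..}" using n dvd_imp_le[of p n] by (force simp: rough_numbers_def)
    qed
    note sub = this
    have "infsum ?h (rough_numbers K) = infsum ?h {1} + infsum ?h (rough_numbers K - {1})"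
      by (subst infsum_Un_disjoint[symmetric])
        (use 1 Infinite_Sum.abs_summable_summable[OF sm] in \<open>auto simp: insert_absorb\<close>)
    then have "norm (infsum ?h (rough_numbers K) - 1) = norm (infsum ?h (rough_numbers K - {1}))"
      by simp
    also have "\<dots> \<le> (\<Sum>\<^sub>\<infinity>n\<in>rough_numbers K - {1}. norm (?h n))"
      using sm by (rule norm_infsum_bound)
    also have "\<dots> = infsum ?r (rough_numbers K - {1})"
      by (intro infsum_cong) (auto simp: norm_powr_real_powr rough_numbers_def)
    also have "\<dots> \<le> infsum ?r {Suc K..}"
      using sub by (intro infsum_mono2 smr) auto
    also have "\<dots> = infsum ?r UNIV - (\<Sum>n<Suc K. ?r n)"
    proof -
      have "infsum ?r ({..<Suc K} \<union> {Suc K..}) = infsum ?r {..<Suc K} + infsum ?r {Suc K..}"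
        by (intro infsum_Un_disjoint smr) auto
      moreover have "{..<Suc K} \<union> {Suc K..} = UNIV" by auto
      ultimately show ?thesis by simp
    qed
    finally show ?thesis .
  qed
  moreover have "(\<lambda>K. (\<Sum>\<^sub>\<infinity>n. ?r n) - (\<Sum>n<Suc K. ?r n)) \<longlonglongrightarrow> 0"
  proof -
    have "?r sums (\<Sum>\<^sub>\<infinity>n. ?r n)" by (intro has_sum_imp_sums has_sum_infsum smr)
    then have "(\<lambda>K. \<Sum>n<Suc K. ?r n) \<longlonglongrightarrow> (\<Sum>\<^sub>\<infinity>n. ?r n)" unfolding sums_def by (rule LIMSEQ_Suc)
    from tendsto_diff[OF tendsto_const[of "\<Sum>\<^sub>\<infinity>n. ?r n"] this] show ?thesis
      by (simp del: sum.lessThan_Suc)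
  qed
  ultimately have "(\<lambda>K. infsum ?h (rough_numbers K) - 1) \<longlonglongrightarrow> 0"
    by (rule Lim_null_comparison[OF always_eventually[OF allI]])
  then show ?thesis
    unfolding infsum_rough_numbers[OF assms] by (rule LIM_zero_cancel)
qed

text \<open>With r = p^(-\<sigma>) and \<theta> = v ln p, the squared modulus is (1 - r)^2 + 2 r (1
  - cos \<theta>). Since r \<le> 1/2, (1 - r)^2 is at least 1/4, so the relative excess is at most 8
  r (1 - cos \<theta>); the square root halves 8 to 4. The exponential form turns products over
  primes into sums.\<close>

lemma norm_euler_factor_le:
  fixes p :: nat and \<sigma> v :: real
  assumes "p \<ge> 2" "\<sigma> \<ge> 1"
  shows "norm (1 - of_nat p powr (- Complex \<sigma> v) :: complex) \<le>
     norm (1 - of_nat p powr (- of_real \<sigma>) :: complex) * exp (4 * ((1 - cos (v * ln p)) / p))"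
proof -
  define r where "r = real p powr (-\<sigma>)"
  define \<theta> where "\<theta> = v * ln p"
  have "r \<le> real p powr (-1)" unfolding r_def using assms by (intro powr_mono) auto
  then have rp: "r \<le> 1 / p" using assms by (simp add: powr_minus divide_inverse)
  also have "\<dots> \<le> 1 / 2" using assms by (intro divide_left_mono) auto
  finally have r: "0 \<le> r" "r \<le> 1 / 2" by (auto simp: r_def)
  have c: "0 \<le> 1 - cos \<theta>" by simp
  have real: "of_nat p powr (- of_real \<sigma>) = (of_real r :: complex)"
    using powr_of_real[of "real p" "-\<sigma>"] by (simp add: r_def)
  have "of_nat p powr (- Complex \<sigma> v) = exp (of_real (- \<sigma> * ln p) + \<i> * of_real (-\<theta>) :: complex)"
    using assms Ln_of_real[of p] by (simp add: powr_def Complex_eq \<theta>_def algebra_simps)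
  also have "\<dots> = of_real r * (cos \<theta> - \<i> * sin \<theta>)"
    unfolding exp_add exp_of_real cis_conv_exp[symmetric]
    using assms by (simp add: r_def powr_def complex_eq_iff)
  finally have "(norm (1 - of_nat p powr (- Complex \<sigma> v) :: complex))\<^sup>2 =
      (1 - r * cos \<theta>)\<^sup>2 + (r * sin \<theta>)\<^sup>2"
    by (simp add: cmod_power2)
  also have "\<dots> = (1 - r)\<^sup>2 + 2 * r * (1 - cos \<theta>)"
  proof -
    have "(1 - r * a)\<^sup>2 + (r * b)\<^sup>2 = 1 - 2 * r * a + r\<^sup>2 * (a\<^sup>2 + b\<^sup>2)" for a b :: real
      by (simp add: power2_eq_square algebra_simps)
    then show ?thesis
      by (simp only: sin_cos_squared_add2) (simp add: power2_eq_square algebra_simps)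
  qed
  also have "\<dots> \<le> (1 - r)\<^sup>2 + (1 - r)\<^sup>2 * (8 * r * (1 - cos \<theta>))"
  proof -
    have "(1/2)\<^sup>2 \<le> (1 - r)\<^sup>2" using r by (intro power_mono) auto
    then have "1 \<le> 4 * (1 - r)\<^sup>2" by (simp add: power2_eq_square)
    moreover have "0 \<le> 2 * r * (1 - cos \<theta>)" using r c by (intro mult_nonneg_nonneg) auto
    ultimately have "1 * (2 * r * (1 - cos \<theta>)) \<le> 4 * (1 - r)\<^sup>2 * (2 * r * (1 - cos \<theta>))"
      by (rule mult_right_mono)
    then show ?thesis by (simp add: algebra_simps)
  qed
  also have "\<dots> = (1 - r)\<^sup>2 * (1 + 8 * r * (1 - cos \<theta>))" by (simp add: algebra_simps)
  also have "\<dots> \<le> (1 - r)\<^sup>2 * (1 + 8 * (1 / p) * (1 - cos \<theta>))"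
    using rp c by (intro mult_left_mono add_left_mono mult_right_mono) auto
  also have "\<dots> \<le> (1 - r)\<^sup>2 * exp (8 * (1 / p) * (1 - cos \<theta>))"
    by (intro mult_left_mono exp_ge_add_one_self) auto
  also have "\<dots> = ((1 - r) * exp (4 * ((1 - cos \<theta>) / p)))\<^sup>2"
    by (simp add: power_mult_distrib flip: exp_double)
  finally have "norm (1 - of_nat p powr (- Complex \<sigma> v) :: complex) \<le> (1 - r) * exp (4 * ((1 - cos \<theta>) / p))"
    by (rule power2_le_imp_le) (use r in auto)
  also have "1 - r = norm (of_real (1 - r) :: complex)"
    using r unfolding norm_of_real by linarith
  also have "\<dots> = norm (1 - of_real r :: complex)" by simp
  finally show ?thesis unfolding real \<theta>_def .
qed

text \<open>The point is that the constant depends on v alone and not on \<sigma>, so it survives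
  the passage to the pole.\<close>

lemma zeta_series_norm_comparison:
  fixes \<sigma> v :: real
  assumes "\<sigma> > 1" and sm: "(\<lambda>p. (1 - cos (v * ln (real p))) / real p) summable_on {p. prime p}"
  shows "norm (zeta_series (of_real \<sigma>)) \<le>
     exp (4 * (\<Sum>\<^sub>\<infinity>p | prime p. (1 - cos (v * ln (real p))) / real p)) * norm (zeta_series (Complex \<sigma> v))"
proof -
  define w where "w = (\<lambda>p::nat. (1 - cos (v * ln (real p))) / real p)"
  have smw: "w summable_on {p. prime p}" using sm unfolding w_def .
  define B where "B = infsum w {p. prime p}"
  define P where "P K s = (\<Prod>p | prime p \<and> p \<le> K. 1 - of_nat p powr (-s))" for K :: nat and s :: complex
  have P: "norm (P K (Complex \<sigma> v)) \<le> exp (4 * B) * norm (P K (of_real \<sigma>))" for K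
  proof -
    have "norm (P K (Complex \<sigma> v)) \<le>
        (\<Prod>p | prime p \<and> p \<le> K. norm (1 - of_nat p powr (- of_real \<sigma>) :: complex) * exp (4 * w p))"
      unfolding P_def prod_norm[symmetric] w_def using assms(1)
      by (intro prod_mono conjI norm_euler_factor_le) (auto dest: prime_ge_2_nat)
    also have "\<dots> = norm (P K (of_real \<sigma>)) * exp (4 * sum w {p. prime p \<and> p \<le> K})"
      by (simp add: prod.distrib P_def prod_norm exp_sum sum_distrib_left)
    also have "sum w {p. prime p \<and> p \<le> K} \<le> B"
      unfolding B_def using smw by (intro finite_sum_le_infsum) (auto simp: w_def)
    finally show ?thesis by (simp add: mult_left_mono mult.commute)
  qed
  \<comment> \<open>Multiplying the comparison \<open>P\<close> by both zeta values completes each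
    partial product to an expression with limit 1; what remains is the comparison of the zeta values
    in the opposite direction.\<close>
  have "norm (1::complex) * norm (zeta_series (of_real \<sigma>)) \<le> exp (4 * B) * norm (zeta_series (Complex \<sigma> v)) * norm (1::complex)"
  proof (rule LIMSEQ_le)
    show "(\<lambda>K. norm (P K (Complex \<sigma> v) * zeta_series (Complex \<sigma> v)) * norm (zeta_series (of_real \<sigma>)))
        \<longlonglongrightarrow> norm (1::complex) * norm (zeta_series (of_real \<sigma>))"
      unfolding P_def using assms(1)
      by (intro tendsto_mult tendsto_norm euler_product_tendsto tendsto_const) auto
    show "(\<lambda>K. exp (4 * B) * norm (zeta_series (Complex \<sigma> v)) * norm (P K (of_real \<sigma>) * zeta_series (of_real \<sigma>)))
        \<longlonglongrightarrow> exp (4 * B) * norm (zeta_series (Complex \<sigma> v)) * norm (1::complex)"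
      unfolding P_def using assms(1)
      by (intro tendsto_mult tendsto_norm euler_product_tendsto tendsto_const) auto
    show "\<exists>N. \<forall>K\<ge>N. norm (P K (Complex \<sigma> v) * zeta_series (Complex \<sigma> v)) * norm (zeta_series (of_real \<sigma>))
      \<le> exp (4 * B) * norm (zeta_series (Complex \<sigma> v)) * norm (P K (of_real \<sigma>) * zeta_series (of_real \<sigma>))"
    proof (intro exI allI impI)
      fix K :: nat
      show "norm (P K (Complex \<sigma> v) * zeta_series (Complex \<sigma> v)) * norm (zeta_series (of_real \<sigma>))
      \<le> exp (4 * B) * norm (zeta_series (Complex \<sigma> v)) * norm (P K (of_real \<sigma>) * zeta_series (of_real \<sigma>))"
        using mult_right_mono[OF P[of K], of "norm (zeta_series (Complex \<sigma> v)) * norm (zeta_series (of_real \<sigma>))"]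
        by (simp add: norm_mult mult_ac)
    qed
  qed
  then show ?thesis by (simp add: B_def w_def)
qed

text \<open>
  Only the pole of the zeta function at \<open>1\<close> and its boundedness near \<open>1 + \<i>v\<close> are needed, not its
  nonvanishing on the line.
\<close>

lemma not_summable_on_primes_one_minus_cos:
  fixes v :: real
  assumes sm: "(\<lambda>p. (1 - cos (v * ln (real p))) / real p) summable_on {p. prime p}"
  shows "v = 0"
proof (rule ccontr)
  assume v: "v \<noteq> 0"
  define E where "E = exp (4 * (\<Sum>\<^sub>\<infinity>p | prime p. (1 - cos (v * ln (real p))) / real p))"
  \<comment> \<open>The pole term at \<sigma> will be C + 1 and its error at most 2 \<sigma> \<le>
    4, so zeta is at least C - 3 there. The upper bound obtained from \<sigma> + iv is C -
    4.\<close>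
  define C where "C = 4 + E * (1 / \<bar>v\<bar> + 2 * (2 + \<bar>v\<bar>))"
  have E: "E > 0" by (simp add: E_def)
  then have C: "C \<ge> 4" using v by (simp add: C_def)
  define \<sigma> where "\<sigma> = 1 + 1 / (C + 1)"
  have \<sigma>: "\<sigma> > 1" "\<sigma> \<le> 2" "1 / (\<sigma> - 1) = C + 1" using C by (auto simp: \<sigma>_def)
  have "norm (1 / (of_real \<sigma> - 1) :: complex) - norm (zeta_series (of_real \<sigma>)) \<le> 2 * norm (of_real \<sigma> :: complex)"
    using zeta_series_near_pole[of "of_real \<sigma>"] \<sigma>
      norm_triangle_ineq2[of "1 / (of_real \<sigma> - 1)" "zeta_series (of_real \<sigma>)"]
    by (simp add: norm_minus_commute)
  moreover have "norm (1 / (of_real \<sigma> - 1) :: complex) = C + 1"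
  proof -
    have "1 / (of_real \<sigma> - 1) = (of_real (C + 1) :: complex)"
      unfolding \<sigma>(3)[symmetric] by simp
    then show ?thesis using C by (metis norm_of_real abs_of_nonneg add_nonneg_nonneg order_trans zero_le_numeral zero_le_one)
  qed
  ultimately have 1: "C + 1 - 4 \<le> norm (zeta_series (of_real \<sigma>))" using \<sigma> by simp
  have "norm (zeta_series (Complex \<sigma> v)) - norm (1 / (Complex \<sigma> v - 1)) \<le> 2 * norm (Complex \<sigma> v)"
    using zeta_series_near_pole[of "Complex \<sigma> v"] \<sigma>
      norm_triangle_ineq2[of "zeta_series (Complex \<sigma> v)" "1 / (Complex \<sigma> v - 1)"] by simp
  moreover have "norm (Complex \<sigma> v) \<le> 2 + \<bar>v\<bar>"
    using cmod_le[of "Complex \<sigma> v"] \<sigma> by simp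
  moreover have "norm (1 / (Complex \<sigma> v - 1)) \<le> 1 / \<bar>v\<bar>"
    using abs_Im_le_cmod[of "Complex \<sigma> v - 1"] v by (simp add: norm_divide divide_left_mono frac_le)
  ultimately have "norm (zeta_series (Complex \<sigma> v)) \<le> 1 / \<bar>v\<bar> + 2 * (2 + \<bar>v\<bar>)"
    by argo
  with zeta_series_norm_comparison[OF \<sigma>(1) sm] E
  have "norm (zeta_series (of_real \<sigma>)) \<le> E * (1 / \<bar>v\<bar> + 2 * (2 + \<bar>v\<bar>))"
    unfolding E_def[symmetric] by (meson less_imp_le mult_left_mono order_trans)
  with 1 show False by (simp add: C_def)
qed

section \<open>Real pretentious functions\<close>

lemma dirichlet_character_1: "dirichlet_character q chi \<Longrightarrow> chi 1 = 1"
  unfolding dirichlet_character_def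
  by (metis coprime_1_left mult_cancel_right2 nat_mult_1)

lemma dirichlet_character_power: "dirichlet_character q chi \<Longrightarrow> chi (n ^ k) = chi n ^ k"
  using dirichlet_character_1[of q chi] by (induction k) (auto simp: dirichlet_character_def)

lemma dirichlet_character_add_mult:
  assumes "dirichlet_character q chi"
  shows "chi (n + k * q) = chi n"
proof (induction k)
  case (Suc k)
  have "chi (n + Suc k * q) = chi ((n + k * q) + q)" by (simp add: add_ac)
  then show ?case using assms Suc by (simp add: dirichlet_character_def)
qed simp

lemma dirichlet_character_mod: "dirichlet_character q chi \<Longrightarrow> chi (n mod q) = chi n"
  using dirichlet_character_add_mult[of q chi "n mod q" "n div q"] by simp

lemma dirichlet_character_power_totient:
  assumes "dirichlet_character q chi" "coprime n q"
  shows "chi n ^ totient q = 1"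
proof -
  have "chi n ^ totient q = chi (n ^ totient q mod q)"
    using assms by (simp add: dirichlet_character_mod dirichlet_character_power)
  also have "n ^ totient q mod q = 1 mod q"
    using euler_theorem[OF assms(2)] by (simp add: cong_def)
  also have "chi \<dots> = 1"
    using assms(1) dirichlet_character_mod dirichlet_character_1 by metis
  finally show ?thesis .
qed

lemma norm_dirichlet_character:
  assumes "dirichlet_character q chi" "coprime n q"
  shows "norm (chi n) = 1"
proof -
  have "norm (chi n) ^ totient q = 1"
    using dirichlet_character_power_totient[OF assms] by (metis norm_one norm_power)
  moreover have "totient q > 0" using assms by (simp add: dirichlet_character_def)
  ultimately show ?thesis by (metis norm_ge_zero power_eq_1_iff abs_of_nonneg real_norm_def less_numeral_extra(3))
qed

lemma norm_dirichlet_character_le: "dirichlet_character q chi \<Longrightarrow> norm (chi n) \<le> 1"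
  by (metis dirichlet_character_def norm_dirichlet_character norm_zero order_refl zero_le_one)

text \<open>On the unit circle |1 - w|^2 = 2 (1 - Re w), and |1 - z^k| \<le> k |1 - z|.\<close>

lemma one_minus_Re_power_le:
  fixes z :: complex
  assumes "norm z = 1"
  shows "1 - Re (z ^ k) \<le> (real k)\<^sup>2 * (1 - Re z)"
proof -
  have sq: "(norm (1 - w))\<^sup>2 = 2 * (1 - Re w)" if "norm w = 1" for w :: complex
  proof -
    have "(Re w)\<^sup>2 + (Im w)\<^sup>2 = 1" using that by (metis cmod_power2 one_power2)
    then show ?thesis unfolding cmod_power2 by (simp add: power2_eq_square algebra_simps)
  qed
  have "norm (1 ^ k - z ^ k) \<le> real k * norm (1 - z)"
    using assms by (intro norm_power_diff) auto
  then have "(norm (1 - z ^ k))\<^sup>2 \<le> (real k)\<^sup>2 * (norm (1 - z))\<^sup>2"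
    unfolding power_mult_distrib[symmetric] by (intro power_mono) auto
  moreover have "norm (z ^ k) = 1" using assms by (simp add: norm_power)
  ultimately have "2 * (1 - Re (z ^ k)) \<le> 2 * ((real k)\<^sup>2 * (1 - Re z))"
    by (simp only: sq assms mult.left_commute[of _ 2])
  then show ?thesis by (rule mult_left_le_imp_le) simp
qed

text \<open>At the primes dividing \<open>q\<close> the character vanishes and termwise estimates
  through |chi(p)| = 1 fail; there are only finitely many of them.\<close>

lemma summable_on_primes_not_dvd_iff:
  fixes g :: "nat \<Rightarrow> real"
  assumes "q > 0"
  shows "g summable_on {p. prime p \<and> \<not> p dvd q} \<longleftrightarrow> g summable_on {p. prime p}"
proof -
  have fin: "finite {p. prime p \<and> p dvd q}"
    by (rule finite_subset[of _ "{..q}"]) (use assms in \<open>auto dest: dvd_imp_le\<close>)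
  have "{p. prime p} = {p. prime p \<and> \<not> p dvd q} \<union> {p. prime p \<and> p dvd q}" by auto
  moreover have "{p. prime p \<and> \<not> p dvd q} = {p. prime p} - {p. prime p \<and> p dvd q}" by auto
  ultimately show ?thesis
    using fin by (metis summable_on_cofin_subset summable_on_finite summable_on_union)
qed

lemma real_pretentious_untwisted:
  fixes f :: "nat \<Rightarrow> complex"
  assumes chi: "dirichlet_character q chi"
    and real: "\<And>n. n > 0 \<Longrightarrow> f n \<in> \<real>" and le1: "\<And>n. n > 0 \<Longrightarrow> norm (f n) \<le> 1"
    and sm: "(\<lambda>p. 1 / real p * (1 - Re (f p * cnj (chi p * of_nat p powr (\<i> * of_real t)))))
          summable_on {p. prime p}" (is "?T summable_on _")
  shows "t = 0"
proof -
  have q: "q > 0" using chi by (simp add: dirichlet_character_def)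
  define k where "k = totient q"
  have k: "k > 0" using q by (simp add: k_def)
  define v where "v = 2 * real k * t"
  have "(1 - cos (v * ln (real p))) / real p \<le> (4 * (real k)\<^sup>2) * ?T p"
    if "prime p" "\<not> p dvd q" for p
  proof -
    have p: "p > 0" using that prime_gt_0_nat by blast
    have cop: "coprime p q" using that by (simp add: prime_imp_coprime)
    define u where "u = of_nat p powr (\<i> * of_real t)"
    define z where "z = chi p * u"
    have u: "u = cis (t * ln p)"
      using p Ln_of_real[of p] by (simp add: u_def powr_def cis_conv_exp mult_ac)
    have nz: "norm z = 1"
      using norm_dirichlet_character[OF chi cop] by (simp add: z_def u norm_mult)
    obtain x where x: "f p = of_real x" using real[OF p] by (auto elim: Reals_cases)
    have x1: "\<bar>x\<bar> \<le> 1" using le1[OF p] x by simp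
    have "(z ^ 2) ^ k = (chi p ^ k) ^ 2 * u ^ (2 * k)"
      by (simp add: z_def power_mult_distrib mult_ac flip: power_mult)
    also have "\<dots> = cis (v * ln p)"
      unfolding k_def dirichlet_character_power_totient[OF chi cop] u
      by (simp add: Complex.DeMoivre v_def k_def mult_ac)
    finally have "1 - cos (v * ln p) = 1 - Re ((z ^ 2) ^ k)" by simp
    also have "\<dots> \<le> (real k)\<^sup>2 * (1 - Re (z ^ 2))"
      using nz by (intro one_minus_Re_power_le) (simp add: norm_power)
    \<comment> \<open>Squaring removes the sign: 1 - Re(z^2) = 2 (1 - |Re z|^2) \<le> 4 (1 - |Re
      z|), while |x| \<le> 1 gives x Re z \<le> |Re z|.\<close>
    also have "1 - Re (z ^ 2) \<le> 4 * (1 - x * Re z)"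
    proof -
      have 1: "(Re z)\<^sup>2 + (Im z)\<^sup>2 = 1" using nz by (metis cmod_power2 one_power2)
      have 2: "\<bar>Re z\<bar> \<le> 1" using abs_Re_le_cmod[of z] nz by simp
      have "1 - Re (z ^ 2) = 2 * (1 - \<bar>Re z\<bar>\<^sup>2)"
        using 1 by (simp add: power2_eq_square algebra_simps)
      also have "\<dots> = 2 * ((1 - \<bar>Re z\<bar>) * (1 + \<bar>Re z\<bar>))" by (simp add: power2_eq_square algebra_simps)
      also have "\<dots> \<le> 2 * ((1 - \<bar>Re z\<bar>) * 2)" using 2 by (intro mult_left_mono) auto
      finally have "1 - Re (z ^ 2) \<le> 4 * (1 - \<bar>Re z\<bar>)" by simp
      moreover have "\<bar>x\<bar> * \<bar>Re z\<bar> \<le> \<bar>Re z\<bar>" using x1 by (simp add: mult_left_le_one_le)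
      ultimately show ?thesis
        using abs_ge_self[of "x * Re z"] unfolding abs_mult by argo
    qed
    finally have "1 - cos (v * ln p) \<le> (real k)\<^sup>2 * (4 * (1 - x * Re z))"
      by (simp add: mult_left_mono)
    then have "(1 - cos (v * ln p)) / p \<le> (real k)\<^sup>2 * (4 * (1 - x * Re z)) / p"
      by (intro divide_right_mono) auto
    also have "x * Re z = Re (f p * cnj z)" by (simp add: x)
    finally have "(1 - cos (v * ln p)) / p \<le> (real k)\<^sup>2 * (4 * (1 - Re (f p * cnj z))) / p" .
    moreover have "(real k)\<^sup>2 * (4 * R) / p = (4 * (real k)\<^sup>2) * (1 / p * R)" for R by simp
    ultimately show ?thesis by (simp only: z_def u_def)
  qed
  then have "(\<lambda>p. (1 - cos (v * ln (real p))) / real p) summable_on {p. prime p \<and> \<not> p dvd q}"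
    by (intro summable_on_comparison_test[OF summable_on_cmult_right[where c = "4 * (real k)\<^sup>2",
        OF sm[folded summable_on_primes_not_dvd_iff[OF q]]]]) auto
  then have "v = 0"
    unfolding summable_on_primes_not_dvd_iff[OF q] by (rule not_summable_on_primes_one_minus_cos)
  then show ?thesis using k by (simp add: v_def)
qed

text \<open>
  The constant depends on \<open>z\<close> and blows up as a nonreal \<open>z\<close> approaches \<open>\<plusminus>1\<close>; it can be made uniform
  over the finitely many values of a character.
\<close>

lemma real_dist_unit_le:
  fixes z :: complex
  assumes "norm z = 1"
  shows "\<exists>C\<ge>0. \<forall>x::real. \<bar>x\<bar> \<le> 1 \<longrightarrow> norm (of_real x - z) \<le> C * (1 - x * Re z)"
proof (cases "Im z = 0")
  case True
  then have z: "z = of_real (Re z)" by (simp add: complex_eq_iff)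
  then have "\<bar>Re z\<bar> = 1" using assms by (metis norm_of_real)
  then consider "Re z = 1" | "Re z = -1" by linarith
  then have "norm (of_real x - z) \<le> 1 * (1 - x * Re z)" if "\<bar>x\<bar> \<le> 1" for x
  proof cases
    case 1
    then have "of_real x - z = of_real (x - 1)" using z by simp
    then show ?thesis using that 1 by (simp only: norm_of_real) simp
  next
    case 2
    then have "of_real x - z = of_real (x + 1)" using z by simp
    then show ?thesis using that 2 by (simp only: norm_of_real) simp
  qed
  then show ?thesis by (intro exI[of _ 1]) auto
next
  case False
  then have "\<bar>Re z\<bar> < norm z"
    by (metis Im_eq_0 abs_Re_le_cmod order_le_less)
  then have d: "1 - \<bar>Re z\<bar> > 0" using assms by simp
  have "norm (of_real x - z) \<le> 2 / (1 - \<bar>Re z\<bar>) * (1 - x * Re z)" if "\<bar>x\<bar> \<le> 1" for x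
  proof -
    have "norm (of_real x - z) \<le> \<bar>x\<bar> + 1"
      using norm_triangle_ineq4[of "of_real x" z] assms by simp
    also have "\<dots> \<le> 2" using that by simp
    also have "\<dots> = 2 / (1 - \<bar>Re z\<bar>) * (1 - \<bar>Re z\<bar>)" using d by (simp add: field_simps)
    also have "\<dots> \<le> 2 / (1 - \<bar>Re z\<bar>) * (1 - x * Re z)"
    proof -
      have "\<bar>x\<bar> * \<bar>Re z\<bar> \<le> \<bar>Re z\<bar>" using that by (simp add: mult_left_le_one_le)
      then have "1 - \<bar>Re z\<bar> \<le> 1 - x * Re z"
        using abs_ge_self[of "x * Re z"] unfolding abs_mult by linarith
      then show ?thesis using d by (intro mult_left_mono) auto
    qed
    finally show ?thesis .
  qed
  then show ?thesis using d by (intro exI[of _ "2 / (1 - \<bar>Re z\<bar>)"]) auto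
qed

text \<open>With t = 0 and f(p) real, the given series has the terms (1 - f(p) Re chi(p)) / p, and
  at primes not dividing \<open>q\<close> these dominate the first power of |f(p) - chi(p)| / p up
  to a constant.\<close>

lemma real_pretentious_absolutely:
  fixes f :: "nat \<Rightarrow> complex"
  assumes "pretentious f"
    and real: "\<And>n. n > 0 \<Longrightarrow> f n \<in> \<real>" and le1: "\<And>n. n > 0 \<Longrightarrow> norm (f n) \<le> 1"
  obtains q chi where "dirichlet_character q chi"
    "(\<lambda>p. norm (f p - chi p) / real p) summable_on {p. prime p}"
proof -
  obtain q chi t where chi: "dirichlet_character q chi"
    and sm: "(\<lambda>p. 1 / real p * (1 - Re (f p * cnj (chi p * of_nat p powr (\<i> * of_real t)))))
          summable_on {p. prime p}"
    using assms(1) unfolding pretentious_def by blast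
  have "t = 0" using real_pretentious_untwisted[OF chi real le1 sm] .
  have q: "q > 0" using chi by (simp add: dirichlet_character_def)
  let ?T = "\<lambda>p. 1 / real p * (1 - Re (f p * cnj (chi p)))"
  have sm0: "?T summable_on {p. prime p}"
    using sm by (rule summable_on_cong[THEN iffD1, rotated]) (simp add: \<open>t = 0\<close>)
  have "\<exists>C\<ge>0. \<forall>x::real. coprime a q \<and> \<bar>x\<bar> \<le> 1 \<longrightarrow> norm (of_real x - chi a) \<le> C * (1 - x * Re (chi a))" for a
    using real_dist_unit_le[of "chi a"] norm_dirichlet_character[OF chi, of a] by (cases "coprime a q") auto
  then obtain C where C0: "\<And>a. C a \<ge> 0"
    and C: "\<And>a x. coprime a q \<Longrightarrow> \<bar>x\<bar> \<le> 1 \<Longrightarrow> norm (of_real x - chi a) \<le> C a * (1 - x * Re (chi a))"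
    by metis
  \<comment> \<open>A character takes one value for each residue, so the sum of the finitely many
    constants serves for every prime.\<close>
  define D where "D = (\<Sum>a<q. C a)"
  have "norm (f p - chi p) / real p \<le> D * ?T p" if "prime p" "\<not> p dvd q" for p
  proof -
    have p: "p > 0" using that prime_gt_0_nat by blast
    have cop: "coprime p q" using that by (simp add: prime_imp_coprime)
    then have cop': "coprime (p mod q) q"
      using q by (simp add: coprime_mod_left_iff)
    obtain x where x: "f p = of_real x" using real[OF p] by (auto elim: Reals_cases)
    have x1: "\<bar>x\<bar> \<le> 1" using le1[OF p] x by simp
    have nonneg: "0 \<le> 1 - x * Re (chi p)"
    proof -
      have "\<bar>x * Re (chi p)\<bar> \<le> 1"
        using x1 abs_Re_le_cmod[of "chi p"] norm_dirichlet_character[OF chi cop]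
        by (simp add: abs_mult mult_le_one)
      then show ?thesis by simp
    qed
    have "norm (f p - chi p) \<le> C (p mod q) * (1 - x * Re (chi p))"
      using C[OF cop' x1] by (simp add: x dirichlet_character_mod[OF chi])
    also have "\<dots> \<le> D * (1 - x * Re (chi p))"
      unfolding D_def using nonneg C0 q by (intro mult_right_mono member_le_sum) auto
    finally have "norm (f p - chi p) / p \<le> D * (1 - x * Re (chi p)) / p"
      by (rule divide_right_mono) simp
    then show ?thesis by (simp add: x)
  qed
  then have "(\<lambda>p. norm (f p - chi p) / real p) summable_on {p. prime p \<and> \<not> p dvd q}"
    by (intro summable_on_comparison_test[OF summable_on_cmult_right[where c = D,
        OF sm0[folded summable_on_primes_not_dvd_iff[OF q]]]]) auto
  then show ?thesis
    using that[OF chi] unfolding summable_on_primes_not_dvd_iff[OF q] by blast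
qed

section \<open>Periodic approximation in mean\<close>

text \<open>A squarefree \<open>m\<close> is a product of distinct primes. Peeling off one prime at
  a time costs one term, because products of numbers in the unit disc satisfy |ab - cd| \<le> |a -
  c| + |b - d|.\<close>

lemma norm_multiplicative_diff_le:
  fixes f g :: "nat \<Rightarrow> complex"
  assumes f: "f \<in> multiplicative_unit_class" and g: "g \<in> multiplicative_unit_class"
    and one: "f 1 = g 1"
    and "m > 0" "\<And>p. prime p \<Longrightarrow> \<not> p\<^sup>2 dvd m"
  shows "norm (f m - g m) \<le> (\<Sum>p | prime p \<and> p dvd m. norm (f p - g p))"
  using assms(4,5)
proof (induction m rule: less_induct)
  case (less m)
  show ?case
  proof (cases "m = 1")
    case True
    then show ?thesis using one by (simp add: sum_nonneg)
  next
    case False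
    then obtain p where p: "prime p" "p dvd m" using prime_factor_nat by blast
    then obtain y where y: "m = p * y" by (auto elim: dvdE)
    have y0: "y > 0" and p0: "p > 0" using less.prems y by auto
    have py: "\<not> p dvd y" using less.prems(2)[OF p(1)] y by (auto simp: power2_eq_square)
    have cop: "coprime p y" using p(1) py by (simp add: prime_imp_coprime)
    have "y < m" using y y0 prime_gt_1_nat[OF p(1)] by simp
    moreover have "\<not> r\<^sup>2 dvd y" if "prime r" for r
      using less.prems(2)[OF that] y by auto
    ultimately have IH: "norm (f y - g y) \<le> (\<Sum>r | prime r \<and> r dvd y. norm (f r - g r))"
      using less.IH y0 by blast
    have "{r. prime r \<and> r dvd m} = insert p {r. prime r \<and> r dvd y}"
      using p(1) by (auto simp: y prime_dvd_mult_iff dest: primes_dvd_imp_eq)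
    moreover have "finite {r. prime r \<and> r dvd y}" using y0 by simp
    ultimately have S: "(\<Sum>r | prime r \<and> r dvd m. norm (f r - g r)) =
        norm (f p - g p) + (\<Sum>r | prime r \<and> r dvd y. norm (f r - g r))"
      using py by simp
    have "f m = f p * f y" "g m = g p * g y"
      using f g cop y0 p0 by (auto simp: multiplicative_unit_class_def y)
    then have "norm (f m - g m) \<le> norm (f p - g p) + norm (f y - g y)"
      using f g y0 p0 norm_prod_diff[of "{True, False}" "\<lambda>b. if b then f p else f y" "\<lambda>b. if b then g p else g y"]
      by (auto simp: multiplicative_unit_class_def)
    then show ?thesis using IH S by linarith
  qed
qed

lemma card_multiples_le:
  assumes "d > 0"
  shows "real (card {n\<in>{1..N}. d dvd n}) \<le> real N / real d"
proof -
  have "{n\<in>{1..N}. d dvd n} = (*) d ` {1..N div d}"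
    using assms by (auto elim!: dvdE simp: less_eq_div_iff_mult_less_eq mult.commute image_iff)
  moreover have "inj_on ((*) d) {1..N div d}" using assms by (auto intro: inj_onI)
  ultimately have "card {n\<in>{1..N}. d dvd n} = N div d" by (simp add: card_image)
  then show ?thesis using of_nat_div_le_of_nat[of N d] by simp
qed

text \<open>Multiples of \<open>d p\<close> have density at most 1 / \<open>d p\<close>. The general
  modulus \<open>d p\<close> allows the use with p, with its square and with a high power of
  it.\<close>

lemma sum_multiples_le:
  fixes c :: "'a \<Rightarrow> real"
  assumes "\<And>p. p \<in> P \<Longrightarrow> d p > 0" "\<And>p. p \<in> P \<Longrightarrow> c p \<ge> 0"
  shows "(\<Sum>n=1..N. \<Sum>p\<in>P. if d p dvd n then c p else 0) \<le> real N * (\<Sum>p\<in>P. c p / real (d p))"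
proof -
  have "(\<Sum>n=1..N. \<Sum>p\<in>P. if d p dvd n then c p else 0) =
      (\<Sum>p\<in>P. \<Sum>n=1..N. if d p dvd n then c p else 0)" by (rule sum.swap)
  also have "\<dots> = (\<Sum>p\<in>P. real (card {n\<in>{1..N}. d p dvd n}) * c p)"
    by (simp add: sum.If_cases Int_def)
  also have "\<dots> \<le> (\<Sum>p\<in>P. real N / real (d p) * c p)"
    using assms by (intro sum_mono mult_right_mono card_multiples_le) auto
  also have "\<dots> = real N * (\<Sum>p\<in>P. c p / real (d p))"
    by (simp add: sum_distrib_left)
  finally show ?thesis .
qed

text \<open>The tail is expressed through finite sets so that one \<open>K\<close> works for the
  primes between \<open>K\<close> and N, uniformly in N.\<close>

lemma summable_on_tail_le:
  fixes h :: "nat \<Rightarrow> real"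
  assumes sm: "h summable_on A" and nonneg: "\<And>n. n \<in> A \<Longrightarrow> h n \<ge> 0" and e: "e > 0"
  obtains K where "\<And>F. finite F \<Longrightarrow> F \<subseteq> A \<inter> {K<..} \<Longrightarrow> sum h F \<le> e"
proof -
  have "(sum h \<longlongrightarrow> infsum h A) (finite_subsets_at_top A)"
    using sm has_sum_infsum unfolding has_sum_def by blast
  then have "\<forall>\<^sub>F F in finite_subsets_at_top A. dist (sum h F) (infsum h A) < e"
    using e by (rule tendstoD)
  then have "\<exists>F0. finite F0 \<and> F0 \<subseteq> A \<and>
      (\<forall>F. finite F \<and> F0 \<subseteq> F \<and> F \<subseteq> A \<longrightarrow> dist (sum h F) (infsum h A) < e)"
    unfolding eventually_finite_subsets_at_top .
  then obtain F0 where F0: "finite F0" "F0 \<subseteq> A" "dist (sum h F0) (infsum h A) < e"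
    by (metis order_refl)
  obtain K where K: "\<And>n. n \<in> F0 \<Longrightarrow> n \<le> K" 
    using F0(1) finite_nat_set_iff_bounded_le by metis
  have "sum h F \<le> e" if F: "finite F" "F \<subseteq> A \<inter> {K<..}" for F
  proof -
    have "sum h F0 + sum h F = sum h (F0 \<union> F)"
      using F F0(1) K by (intro sum.union_disjoint[symmetric]) fastforce+
    also have "\<dots> \<le> infsum h A"
      using F F0 nonneg by (intro finite_sum_le_infsum sm) auto
    also have "\<dots> < sum h F0 + e" using F0(3) by (simp add: dist_real_def)
    finally show ?thesis by simp
  qed
  then show ?thesis using that by blast
qed

lemma dirichlet_character_multiplicative:
  "dirichlet_character q chi \<Longrightarrow> chi \<in> multiplicative_unit_class"
  by (auto simp: multiplicative_unit_class_def norm_dirichlet_character_le)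
    (simp add: dirichlet_character_def)

text \<open>
  The approximant keeps \<open>f\<close> on the part of \<open>n\<close> built from small primes and replaces it by the
  character on the cofactor; cutting the small part off with a gcd makes it periodic.
\<close>

lemma multiplicative_gcd_approximant:
  assumes "dirichlet_character q chi" "f \<in> multiplicative_unit_class" "D > 0"
    and g: "\<And>n. g n = f (gcd n D) * chi (n div gcd n D)"
  shows "g (n + q * D) = g n" "norm (g n) \<le> 1"
proof -
  define d where "d = gcd n D"
  have d: "d > 0" using assms(3) by (simp add: d_def)
  obtain e where e: "D = d * e" by (metis d_def dvdE gcd_dvd2)
  have "gcd (n + q * D) D = d"
    unfolding d_def by (metis gcd.commute gcd_add_mult add.commute)
  moreover have "(n + q * D) div d = n div d + e * q"
  proof -
    have "n + q * D = n + d * (e * q)" using e by simp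
    then have "(n + q * D) div d = (n + d * (e * q)) div d" by (rule arg_cong)
    then show ?thesis using d by simp
  qed
  ultimately show "g (n + q * D) = g n"
    using dirichlet_character_add_mult[OF assms(1)] by (simp add: g flip: d_def)
  show "norm (g n) \<le> 1"
    unfolding g norm_mult d_def[symmetric] using assms d norm_dirichlet_character_le[OF assms(1)]
    by (intro mult_le_one) (auto simp: multiplicative_unit_class_def)
qed

text \<open>The hypothesis \<open>small\<close> makes the gcd with \<open>D\<close> absorb the full
  power of each prime up to \<open>K\<close>, so the cofactor is coprime to it and \<open>f\<close>
  splits; \<open>large\<close> makes the cofactor squarefree. Only primes above \<open>K\<close>
  then contribute.\<close>

lemma multiplicative_gcd_approximant_error:
  assumes chi: "dirichlet_character q chi" and f: "f \<in> multiplicative_unit_class" and one: "f 1 = 1"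
    and D: "D = (\<Prod>p | prime p \<and> p \<le> K. p ^ A)" and n: "n > 0" "n \<le> N"
    and small: "\<And>p. prime p \<Longrightarrow> p \<le> K \<Longrightarrow> \<not> p ^ Suc A dvd n"
    and large: "\<And>p. prime p \<Longrightarrow> p > K \<Longrightarrow> \<not> p\<^sup>2 dvd n"
  shows "norm (f n - f (gcd n D) * chi (n div gcd n D)) \<le>
     (\<Sum>p | prime p \<and> K < p \<and> p \<le> N. if p dvd n then norm (f p - chi p) else 0)"
proof -
  define d where "d = gcd n D"
  define m where "m = n div d"
  have nm: "n = d * m" by (simp add: m_def d_def)
  have m0: "m > 0" and d0: "d > 0" using n(1) unfolding nm by auto
  have rough: "K < p" if p: "prime p" "p dvd m" for p
  proof (rule ccontr)
    assume "\<not> K < p"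
    then have pK: "p \<le> K" by simp
    define v where "v = multiplicity p n"
    have "p ^ v dvd n" by (simp add: v_def multiplicity_dvd)
    moreover have "v \<le> A"
    proof (rule ccontr)
      assume "\<not> v \<le> A"
      then have "p ^ Suc A dvd p ^ v" by (intro le_imp_power_dvd) simp
      then show False using small[OF p(1) pK] \<open>p ^ v dvd n\<close> dvd_trans by blast
    qed
    then have "p ^ v dvd p ^ A" by (rule le_imp_power_dvd)
    moreover have "p ^ A dvd D" unfolding D using p pK by (intro dvd_prodI) auto
    ultimately have "p ^ v dvd d" unfolding d_def by (meson dvd_trans gcd_greatest)
    then have "p ^ v * p dvd n" unfolding nm using p(2) by (rule mult_dvd_mono)
    then have "p ^ Suc v dvd n" by (simp add: mult.commute)
    moreover have "\<not> p ^ Suc v dvd n"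
      using n prime_gt_1_nat[OF p(1)] unfolding v_def by (subst power_dvd_iff_le_multiplicity) auto
    ultimately show False by blast
  qed
  have "coprime d m"
  proof (rule ccontr)
    assume "\<not> coprime d m"
    then obtain p where p: "prime p" "p dvd d" "p dvd m"
      by (metis coprime_iff_gcd_eq_1 gcd_dvd1 gcd_dvd2 dvd_trans prime_factor_nat)
    then have "p dvd D" by (metis d_def dvd_trans gcd_dvd2)
    then obtain r where "prime r" "r \<le> K" "p dvd r ^ A"
      unfolding D using p(1) by (auto simp: prime_dvd_prod_iff)
    then have "p \<le> K" using p(1) by (metis prime_dvd_power primes_dvd_imp_eq)
    then show False using rough[OF p(1,3)] by simp
  qed
  then have "f n = f d * f m" using f m0 d0 by (simp add: multiplicative_unit_class_def nm)
  then have "norm (f n - f d * chi m) = norm (f d) * norm (f m - chi m)"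
    by (simp add: norm_mult flip: right_diff_distrib)
  also have "\<dots> \<le> norm (f m - chi m)"
    using f d0 by (intro mult_left_le_one_le) (auto simp: multiplicative_unit_class_def)
  also have "\<dots> \<le> (\<Sum>p | prime p \<and> p dvd m. norm (f p - chi p))"
  proof -
    have "\<not> p\<^sup>2 dvd m" if p: "prime p" for p
      using large[OF p] rough[OF p] nm by (metis dvd_mult dvd_power dvd_trans pos2)
    moreover have "f 1 = chi 1" using one dirichlet_character_1[OF chi] by simp
    ultimately show ?thesis
      using norm_multiplicative_diff_le[OF f dirichlet_character_multiplicative[OF chi] _ m0] by blast
  qed
  also have "\<dots> \<le> (\<Sum>p | prime p \<and> K < p \<and> p \<le> N. if p dvd n then norm (f p - chi p) else 0)"
  proof -
    have "m \<le> N" using n nm d0 by (metis dvd_imp_le dvd_triv_right order_trans)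
    then have "{p. prime p \<and> p dvd m} \<subseteq> {p\<in>{p. prime p \<and> K < p \<and> p \<le> N}. p dvd n}"
      using rough m0 by (auto simp: nm dest: dvd_imp_le)
    then have "(\<Sum>p | prime p \<and> p dvd m. norm (f p - chi p)) \<le>
        (\<Sum>p\<in>{p\<in>{p. prime p \<and> K < p \<and> p \<le> N}. p dvd n}. norm (f p - chi p))"
      by (intro sum_mono2) auto
    also have "\<dots> = (\<Sum>p | prime p \<and> K < p \<and> p \<le> N. if p dvd n then norm (f p - chi p) else 0)"
      by (rule sum.inter_filter) simp
    finally show ?thesis .
  qed
  finally show ?thesis by (simp add: m_def d_def)
qed


text \<open>Integers divisible by a high power of a small prime or by the square of a large one have
  small density. On all others the error is charged to the large primes dividing n, where the
  convergent series has a small tail.\<close>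

lemma multiplicative_periodic_approximation:
  assumes chi: "dirichlet_character q chi" and f: "f \<in> multiplicative_unit_class"
    and sm: "(\<lambda>p. norm (f p - chi p) / real p) summable_on {p. prime p}"
    and e: "e > 0"
  shows "\<exists>Q>0. \<exists>g. (\<forall>n. g (n + Q) = g n) \<and> (\<forall>n. norm (g n) \<le> 1) \<and>
     (\<forall>N. (\<Sum>n=1..N. norm (f n - g n)) \<le> e * real N)"
proof (cases "f 1 = 1")
  case False
  \<comment> \<open>Multiplicativity at 1 forces \<open>f 1\<close> to be 0 or 1, and the value 0
    annihilates \<open>f\<close> on the positive integers.\<close>
  have "f n = 0" if "n > 0" for n
  proof -
    have "f (n * 1) = f n * f 1" "f (1 * 1) = f 1 * f 1"
      using f that unfolding multiplicative_unit_class_def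
      by (metis (mono_tags, lifting) coprime_1_right mem_Collect_eq zero_less_one)+
    then show ?thesis using False by auto
  qed
  then show ?thesis using e
    by (intro exI[of _ 1] conjI exI[of _ "\<lambda>_. 0"]) auto
next
  case True
  \<comment> \<open>The mean cost of a large prime: replacing \<open>f\<close> by the character at
    its multiples, plus the trivial bound 2 at the multiples of its square.\<close>
  define h where "h = (\<lambda>p. norm (f p - chi p) / real p + 2 / (real p)\<^sup>2)"
  have "(\<lambda>p. 2 / (real p)\<^sup>2) summable_on UNIV"
    using summable_mult[OF inverse_power_summable[of 2, where 'a = real], of 2]
    by (subst summable_on_UNIV_nonneg_real_iff) (auto simp: divide_inverse power_inverse)
  then have "h summable_on {p. prime p}"
    unfolding h_def by (intro summable_on_add sm) (rule summable_on_subset_banach, auto)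
  then obtain K where K: "\<And>F. finite F \<Longrightarrow> F \<subseteq> {p. prime p} \<inter> {K<..} \<Longrightarrow> sum h F \<le> e / 2"
    using e summable_on_tail_le[of h "{p. prime p}" "e / 2"] by (auto simp: h_def)
  \<comment> \<open>There are at most \<open>K\<close> small primes, all at least 2, and each costs
    at most 2 (1/2)^(A+1) in mean. The exponent is chosen after \<open>K\<close>.\<close>
  have "(\<lambda>A. 2 * real K * (1 / 2) ^ Suc A) \<longlonglongrightarrow> 2 * real K * 0"
    by (intro tendsto_mult tendsto_const LIMSEQ_Suc LIMSEQ_power_zero) simp
  then have "\<forall>\<^sub>F A in sequentially. 2 * real K * (1 / 2) ^ Suc A < e / 2"
    using e by (intro order_tendstoD) auto
  then obtain A where A: "2 * real K * (1 / 2) ^ Suc A < e / 2"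
    by (auto simp: eventually_sequentially)
  define P where "P = {p. prime p \<and> p \<le> K}"
  have finP: "finite P" by (simp add: P_def)
  define D where "D = (\<Prod>p\<in>P. p ^ A)"
  have D: "D > 0" unfolding D_def P_def by (intro prod_pos) (auto dest: prime_gt_0_nat)
  define g where "g n = f (gcd n D) * chi (n div gcd n D)" for n
  note g = multiplicative_gcd_approximant[OF chi f D g_def]
  have "(\<Sum>n=1..N. norm (f n - g n)) \<le> e * real N" for N
  proof -
    define R where "R = {p. prime p \<and> K < p \<and> p \<le> N}"
    have finR: "finite R" by (simp add: R_def)
    \<comment> \<open>The charge \<open>s1\<close> pays for the change of values at large primes;
      \<open>s2\<close> and \<open>s3\<close> pay 2 on the exceptional integers, where the gcd does
      not separate the factors properly.\<close>
    define s1 where "s1 n = (\<Sum>p\<in>R. if p dvd n then norm (f p - chi p) else 0)" for n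
    define s2 where "s2 n = (\<Sum>p\<in>R. if p\<^sup>2 dvd n then 2 else 0 :: real)" for n
    define s3 where "s3 n = (\<Sum>p\<in>P. if p ^ Suc A dvd n then 2 else 0 :: real)" for n
    have nonneg: "s1 n \<ge> 0" "s2 n \<ge> 0" "s3 n \<ge> 0" for n
      by (auto simp: s1_def s2_def s3_def intro!: sum_nonneg)
    have "norm (f n - g n) \<le> s1 n + s2 n + s3 n" if n: "n \<in> {1..N}" for n
    proof -
      have n0: "n > 0" using n by simp
      have two: "norm (f n - g n) \<le> 2"
      proof -
        have "norm (f n) \<le> 1" using f n0 by (simp add: multiplicative_unit_class_def)
        then show ?thesis using norm_triangle_ineq4[of "f n" "g n"] g(2)[of n] by linarith
      qed
      consider (small) p where "p \<in> P" "p ^ Suc A dvd n"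
        | (large) p where "prime p" "K < p" "p\<^sup>2 dvd n"
        | (good) "\<And>p. prime p \<Longrightarrow> p \<le> K \<Longrightarrow> \<not> p ^ Suc A dvd n" "\<And>p. prime p \<Longrightarrow> p > K \<Longrightarrow> \<not> p\<^sup>2 dvd n"
        unfolding P_def by blast
      then show ?thesis
      proof cases
        case small
        then have "2 \<le> s3 n"
          unfolding s3_def using member_le_sum[of p P "\<lambda>p. if p ^ Suc A dvd n then 2 else 0 :: real"] finP
          by simp
        then show ?thesis using two nonneg[of n] by linarith
      next
        case large
        have "p dvd n" using large(3) by (metis dvd_power dvd_trans pos2)
        then have "p \<in> R" using large n0 n by (auto simp: R_def dest: dvd_imp_le)
        then have "2 \<le> s2 n"
          unfolding s2_def using large member_le_sum[of p R "\<lambda>p. if p\<^sup>2 dvd n then 2 else 0 :: real"] finR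
          by simp
        then show ?thesis using two nonneg[of n] by linarith
      next
        case good
        have "norm (f n - g n) \<le> s1 n"
          unfolding g_def s1_def R_def
          using n by (intro multiplicative_gcd_approximant_error[OF chi f True _ _ _ good]) (auto simp: D_def P_def)
        then show ?thesis using nonneg[of n] by linarith
      qed
    qed
    then have "(\<Sum>n=1..N. norm (f n - g n)) \<le> (\<Sum>n=1..N. s1 n + s2 n + s3 n)"
      by (rule sum_mono)
    also have "\<dots> = (\<Sum>n=1..N. s1 n) + (\<Sum>n=1..N. s2 n) + (\<Sum>n=1..N. s3 n)"
      by (simp add: sum.distrib)
    also have "\<dots> \<le> real N * (\<Sum>p\<in>R. norm (f p - chi p) / real p) + real N * (\<Sum>p\<in>R. 2 / real (p\<^sup>2))
        + real N * (\<Sum>p\<in>P. 2 / real (p ^ Suc A))"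
      unfolding s1_def s2_def s3_def
      by (intro add_mono sum_multiples_le) (auto simp: R_def P_def dest: prime_gt_0_nat)
    also have "\<dots> = real N * (sum h R + (\<Sum>p\<in>P. 2 / real (p ^ Suc A)))"
      by (simp add: h_def sum.distrib algebra_simps)
    also have "\<dots> \<le> real N * (e / 2 + e / 2)"
    proof (intro mult_left_mono add_mono)
      show "sum h R \<le> e / 2" using finR by (intro K) (auto simp: R_def)
      have "(\<Sum>p\<in>P. 2 / real (p ^ Suc A)) \<le> (\<Sum>p\<in>P. 2 * (1 / 2) ^ Suc A)"
      proof (rule sum_mono)
        fix p assume "p \<in> P"
        then have "2 \<le> real p" using prime_ge_2_nat by (auto simp: P_def)
        then have "2 ^ Suc A \<le> real p ^ Suc A" by (rule power_mono) simp
        then show "2 / real (p ^ Suc A) \<le> 2 * (1 / 2) ^ Suc A"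
          unfolding power_one_over of_nat_power by (simp add: frac_le del: power_Suc)
      qed
      also have "\<dots> = real (card P) * (2 * (1 / 2) ^ Suc A)" by simp
      also have "card P \<le> card {1..K}"
        by (intro card_mono) (auto simp: P_def dest: prime_ge_1_nat)
      then have "real (card P) * (2 * (1 / 2) ^ Suc A) \<le> real K * (2 * (1 / 2) ^ Suc A)"
        by (intro mult_right_mono) auto
      also have "\<dots> \<le> e / 2" using A by simp
      finally show "(\<Sum>p\<in>P. 2 / real (p ^ Suc A)) \<le> e / 2" .
    qed auto
    finally show ?thesis by (simp add: mult.commute)
  qed
  moreover have "q * D > 0" using D chi by (simp add: dirichlet_character_def)
  ultimately show ?thesis using g by blast
qed

section \<open>The law of a limit-periodic sequence\<close>

definition disc_sequences :: "(int \<Rightarrow> complex) set" where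
  "disc_sequences = {x. \<forall>n. norm (x n) \<le> 1}"

lemma compact_disc_sequences: "compact disc_sequences"
proof -
  have "compactin (product_topology (\<lambda>_::int. euclidean) UNIV) (PiE UNIV (\<lambda>_. cball (0::complex) 1))"
    by (subst compactin_PiE) (auto simp: compactin_euclidean_iff)
  moreover have "PiE UNIV (\<lambda>_. cball 0 1) = disc_sequences"
    by (auto simp: disc_sequences_def)
  ultimately show ?thesis by (simp add: euclidean_product_topology compactin_euclidean_iff)
qed

text \<open>
  A uniform modulus of continuity, with the metric of the product space replaced by an
  \<open>\<ell>\<^sup>1\<close> distance on finitely many coordinates, which is what can be averaged along an orbit.
\<close>

lemma continuous_on_disc_sequences_modulus:
  fixes G :: "(int \<Rightarrow> complex) \<Rightarrow> complex"
  assumes G: "continuous_on disc_sequences G" and e: "e > 0"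
  obtains J C where "finite J" "C \<ge> 0"
    "\<And>x y. x \<in> disc_sequences \<Longrightarrow> y \<in> disc_sequences \<Longrightarrow>
       norm (G x - G y) \<le> e + C * (\<Sum>m\<in>J. norm (x m - y m))"
proof -
  have "uniformly_continuous_on disc_sequences G"
    using G compact_disc_sequences by (rule compact_uniformly_continuous)
  then obtain d where d: "d > 0" "\<And>x y. x \<in> disc_sequences \<Longrightarrow> y \<in> disc_sequences \<Longrightarrow>
      dist y x < d \<Longrightarrow> dist (G y) (G x) < e"
    unfolding uniformly_continuous_on_def using e by metis
  have "bounded (G ` disc_sequences)"
    by (intro compact_imp_bounded compact_continuous_image G compact_disc_sequences)
  then obtain B where B: "B > 0" "\<And>x. x \<in> disc_sequences \<Longrightarrow> norm (G x) \<le> B"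
    unfolding bounded_pos by auto
  obtain N where N: "(1 / 2) ^ N < d / 2"
    using real_arch_pow_inv[of "d / 2" "1 / 2"] d(1) by auto
  define J where "J = (from_nat ` {..N} :: int set)"
  have finJ: "finite J" by (simp add: J_def)
  \<comment> \<open>If the coordinate distance is below d/4, the metric is below 2 d/4 + d/2 = d.
    Otherwise the factor 8 B / d lifts d/4 to the trivial bound 2 B.\<close>
  have "norm (G x - G y) \<le> e + (8 * B / d) * (\<Sum>m\<in>J. norm (x m - y m))"
    if xy: "x \<in> disc_sequences" "y \<in> disc_sequences" for x y
  proof (cases "(\<Sum>m\<in>J. norm (x m - y m)) < d / 4")
    case True
    let ?S = "{dist (x (from_nat n)) (y (from_nat n)) | n. n \<le> N}"
    have "?S = (\<lambda>n. dist (x (from_nat n)) (y (from_nat n))) ` {..N}" by auto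
    then have fin: "finite ?S" "?S \<noteq> {}" by auto
    have "s < d / 4" if s: "s \<in> ?S" for s
    proof -
      obtain n where n: "n \<le> N" "s = dist (x (from_nat n)) (y (from_nat n))" using s by blast
      then have "from_nat n \<in> J" by (simp add: J_def)
      then have "norm (x (from_nat n) - y (from_nat n)) \<le> (\<Sum>m\<in>J. norm (x m - y m))"
        using finJ by (intro member_le_sum[of _ _ "\<lambda>m. norm (x m - y m)"]) auto
      then show ?thesis using True n by (simp add: dist_norm)
    qed
    then have "Max ?S < d / 4" using fin by (subst Max_less_iff) auto
    then have "dist x y < d" using dist_fun_le_dist_first_terms[of x y N] N by linarith
    then have "dist (G x) (G y) < e" using d(2)[OF xy(2,1)] by blast
    moreover have "0 \<le> (8 * B / d) * (\<Sum>m\<in>J. norm (x m - y m))"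
      using B d by (intro mult_nonneg_nonneg sum_nonneg) auto
    ultimately show ?thesis by (simp add: dist_norm)
  next
    case False
    have "norm (G x - G y) \<le> 2 * B"
      using norm_triangle_ineq4[of "G x" "G y"] B(2)[OF xy(1)] B(2)[OF xy(2)] by linarith
    also have "\<dots> = (8 * B / d) * (d / 4)" using d by simp
    also have "\<dots> \<le> (8 * B / d) * (\<Sum>m\<in>J. norm (x m - y m))"
      using False B d by (intro mult_left_mono) auto
    finally show ?thesis using e by linarith
  qed
  moreover have "8 * B / d \<ge> 0" using B d by simp
  ultimately show ?thesis using that finJ by blast
qed

text \<open>A window of length \<open>Q\<close> has the same sum wherever it starts, so the centred
  partial sums \<open>T\<close> are themselves periodic, hence bounded, and vanish after division by
  N.\<close>

lemma periodic_average_tendsto: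
  fixes H :: "nat \<Rightarrow> complex"
  assumes Q: "Q > 0" and per: "\<And>n. H (n + Q) = H n"
  shows "(\<lambda>N. (\<Sum>n=1..N. H n) / of_nat N) \<longlonglongrightarrow> (\<Sum>i<Q. H i) / of_nat Q"
proof -
  define c where "c = (\<Sum>i<Q. H i) / of_nat Q"
  define T where "T N = (\<Sum>n=1..N. H n - c)" for N
  have T: "T N = (\<Sum>n=1..N. H n) - of_nat N * c" for N by (simp add: T_def sum_subtractf)
  have window: "(\<Sum>n=Suc N..N + Q. H n) = (\<Sum>i<Q. H i)" for N
  proof (induction N)
    case 0
    have "(\<Sum>n=Suc 0..Q. H n) = (\<Sum>i<Q. H (Suc i))"
      by (rule sum.reindex_bij_witness[of _ Suc "\<lambda>n. n - 1"]) auto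
    also have "\<dots> = (\<Sum>i<Q. H i) + H Q - H 0"
      using sum.lessThan_Suc_shift[of H Q] by simp
    finally show ?case using per[of 0] by simp
  next
    case (Suc N)
    have "(\<Sum>n=Suc N..Suc (N + Q). H n) = H (Suc N) + (\<Sum>n=Suc (Suc N)..Suc (N + Q). H n)"
      by (rule sum.atLeast_Suc_atMost) simp
    moreover have "(\<Sum>n=Suc N..Suc (N + Q). H n) = (\<Sum>n=Suc N..N + Q. H n) + H (Suc (N + Q))"
      using Q by simp
    ultimately show ?case using Suc per[of "Suc N"] by simp
  qed
  have T_per: "T (N + Q) = T N" for N
  proof -
    have "(\<Sum>n=1..N + Q. H n) = (\<Sum>n=1..N. H n) + (\<Sum>n=Suc N..N + Q. H n)"
      using sum.ub_add_nat[of 1 N H Q] by simp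
    then show ?thesis unfolding T window using Q by (simp add: c_def field_simps)
  qed
  have "T (N + k * Q) = T N" for N k
  proof (induction k)
    case (Suc k)
    then show ?case using T_per[of "N + k * Q"] by (simp add: add_ac)
  qed simp
  then have T_mod: "T N = T (N mod Q)" for N
    by (metis mod_mult_div_eq mult.commute)
  define B where "B = (\<Sum>i<Q. norm (T i))"
  have "norm (T N) \<le> B" for N
    unfolding B_def by (subst T_mod, rule member_le_sum) (use Q in auto)
  then have "norm (T N / of_nat N) \<le> B / real N" for N
    by (simp add: norm_divide divide_right_mono)
  moreover have "(\<lambda>N. B / real N) \<longlonglongrightarrow> 0" by (rule lim_const_over_n)
  ultimately have "(\<lambda>N. T N / of_nat N) \<longlonglongrightarrow> 0"
    by (rule Lim_null_comparison[OF always_eventually[OF allI]])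
  then have "(\<lambda>N. T N / of_nat N + c) \<longlonglongrightarrow> 0 + c" by (intro tendsto_add tendsto_const)
  moreover have "\<forall>\<^sub>F N in sequentially. T N / of_nat N + c = (\<Sum>n=1..N. H n) / of_nat N"
    using eventually_gt_at_top[of 0] by eventually_elim (simp add: T field_simps)
  ultimately show ?thesis unfolding c_def by (simp add: Lim_transform_eventually)
qed

lemma periodic_sum_shift:
  fixes w :: "int \<Rightarrow> 'a::ab_group_add"
  assumes per: "\<And>j. w (j + int Q) = w j"
  shows "(\<Sum>i<Q. w (int i + m)) = (\<Sum>i<Q. w (int i))"
proof -
  have step: "(\<Sum>i<Q. w (int i + (m + 1))) = (\<Sum>i<Q. w (int i + m))" for m
  proof -
    have "(\<Sum>i<Suc Q. w (int i + m)) = w m + (\<Sum>i<Q. w (int i + (m + 1)))"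
      by (subst sum.lessThan_Suc_shift) (simp add: add_ac)
    moreover have "w (int Q + m) = w m" using per[of m] by (simp add: add.commute)
    ultimately show ?thesis by simp
  qed
  show ?thesis
  proof (induction m rule: int_induct[of _ 0])
    case (step2 i)
    then show ?case using step[of "i - 1"] by simp
  qed (use step in \<open>simp_all add: add_ac\<close>)
qed

section \<open>A random point of the odometer\<close>

definition unit_interval_measure :: "real measure" where
  "unit_interval_measure = restrict_space lborel {0..<1}"

lemma prob_space_unit_interval_measure: "prob_space unit_interval_measure"
  unfolding unit_interval_measure_def by (intro prob_space_restrict_space) auto

lemma space_unit_interval_measure: "space unit_interval_measure = {0..<1}"
  by (simp add: unit_interval_measure_def space_restrict_space)

lemma measurable_nat_floor_unit_interval [measurable]:
  "(\<lambda>\<omega>. nat \<lfloor>\<omega> * real Q\<rfloor>) \<in> unit_interval_measure \<rightarrow>\<^sub>M count_space UNIV"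
  unfolding unit_interval_measure_def by (intro measurable_restrict_space1) measurable

text \<open>On the half-open interval the floors are exactly the integers from 0 to \<open>Q\<close>
  - 1, each taken on an interval of length 1 / \<open>Q\<close>.\<close>

lemma integral_nat_floor_unit_interval:
  fixes h :: "nat \<Rightarrow> 'b::{banach, second_countable_topology}"
  assumes Q: "Q > 0"
  shows "(\<integral>\<omega>. h (nat \<lfloor>\<omega> * real Q\<rfloor>) \<partial>unit_interval_measure) = (\<Sum>i<Q. h i) /\<^sub>R real Q"
proof -
  have eq: "indicator {0..<1} \<omega> *\<^sub>R h (nat \<lfloor>\<omega> * real Q\<rfloor>) =
      (\<Sum>i<Q. indicator {real i / real Q..<(real i + 1) / real Q} \<omega> *\<^sub>R h i)" for \<omega>
  proof -
    have mem: "\<omega> \<in> {real i / real Q..<(real i + 1) / real Q} \<longleftrightarrow> \<lfloor>\<omega> * real Q\<rfloor> = int i" for i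
      using Q by (simp add: floor_eq_iff field_simps)
    show ?thesis
    proof (cases "\<omega> \<in> {0..<1}")
      case True
      define j where "j = nat \<lfloor>\<omega> * real Q\<rfloor>"
      have j: "\<lfloor>\<omega> * real Q\<rfloor> = int j" using True by (simp add: j_def)
      have "\<omega> * real Q < real Q" using True Q by simp
      then have "j < Q" using j by (metis floor_less_iff of_int_of_nat_eq of_nat_less_iff)
      have "(\<Sum>i<Q. indicator {real i / real Q..<(real i + 1) / real Q} \<omega> *\<^sub>R h i) =
          (\<Sum>i<Q. if i = j then h i else 0)"
        unfolding indicator_def mem j by (intro sum.cong) auto
      then show ?thesis using True \<open>j < Q\<close> by (simp add: j_def)
    next
      case False
      have "indicator {real i / real Q..<(real i + 1) / real Q} \<omega> = (0::real)" if "i < Q" for i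
      proof -
        have "\<lfloor>\<omega> * real Q\<rfloor> \<noteq> int i"
        proof
          assume "\<lfloor>\<omega> * real Q\<rfloor> = int i"
          then have "real i \<le> \<omega> * real Q" "\<omega> * real Q < real i + 1" by (simp_all add: floor_eq_iff)
          moreover have "real i + 1 \<le> real Q" using that by linarith
          ultimately have "0 \<le> \<omega> * real Q" "\<omega> * real Q < 1 * real Q" by linarith+
          then have "0 \<le> \<omega>" "\<omega> < 1" using Q by (auto simp: zero_le_mult_iff)
          then show False using False by simp
        qed
        then show ?thesis unfolding indicator_def mem by simp
      qed
      then show ?thesis using False by simp
    qed
  qed
  have "(\<integral>\<omega>. h (nat \<lfloor>\<omega> * real Q\<rfloor>) \<partial>unit_interval_measure) =
      (\<integral>\<omega>. (\<Sum>i<Q. indicator {real i / real Q..<(real i + 1) / real Q} \<omega> *\<^sub>R h i) \<partial>lborel)"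
    unfolding unit_interval_measure_def by (subst integral_restrict_space) (auto simp: eq)
  also have "\<dots> = (\<Sum>i<Q. \<integral>\<omega>. indicator {real i / real Q..<(real i + 1) / real Q} \<omega> *\<^sub>R h i \<partial>lborel)"
    by (intro Bochner_Integration.integral_sum integrable_scaleR_left integrable_real_indicator) (auto simp: divide_right_mono)
  also have "\<dots> = (\<Sum>i<Q. (1 / real Q) *\<^sub>R h i)"
    using Q by (intro sum.cong) (auto simp: divide_right_mono simp flip: diff_divide_distrib)
  also have "\<dots> = (\<Sum>i<Q. h i) /\<^sub>R real Q" by (simp add: scaleR_sum_right divide_inverse)
  finally show ?thesis .
qed

text \<open>
  If the mixed-radix digits of \<open>n\<close> are read from the most significant one, \<open>digit_reversal q k n\<close>
  has the same digits read from the least significant one. Applied to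
  \<open>\<lfloor>\<omega> q\<^sub>0 \<cdots> q\<^sub>k\<^sub>-\<^sub>1\<rfloor>\<close> with \<open>\<omega>\<close> uniform in \<open>[0, 1)\<close>, it yields the coordinates of a Haar
  distributed point of the odometer with moduli \<open>q\<^sub>0 \<cdots> q\<^sub>k\<^sub>-\<^sub>1\<close>.
\<close>

fun digit_reversal :: "(nat \<Rightarrow> nat) \<Rightarrow> nat \<Rightarrow> nat \<Rightarrow> nat" where
  "digit_reversal q 0 n = 0"
| "digit_reversal q (Suc k) n = digit_reversal q k (n div q k) + (\<Prod>j<k. q j) * (n mod q k)"

text \<open>Digit reversal permutes the integers below the product. Stating this through sums of an
  arbitrary \<open>h\<close> is the form needed for integrals, and it lets the induction group by
  the last digit on one side and by the first on the other.\<close>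

lemma sum_digit_reversal:
  fixes h :: "nat \<Rightarrow> 'a::comm_monoid_add"
  assumes q: "\<And>k. q k > 0"
  shows "(\<Sum>n<(\<Prod>j<k. q j). h (digit_reversal q k n)) = (\<Sum>n<(\<Prod>j<k. q j). h n)"
proof (induction k arbitrary: h)
  case (Suc k)
  let ?P = "\<Prod>j<k. q j"
  have "(\<Sum>n<(\<Prod>j<Suc k. q j). h (digit_reversal q (Suc k) n)) =
      (\<Sum>a<?P. \<Sum>n=a * q k..<a * q k + q k. h (digit_reversal q (Suc k) n))"
    by (simp add: sum.nat_group del: digit_reversal.simps)
  also have "\<dots> = (\<Sum>a<?P. \<Sum>d<q k. h (digit_reversal q k a + ?P * d))"
  proof (rule sum.cong)
    fix a
    have "(\<Sum>n=a * q k..<a * q k + q k. h (digit_reversal q (Suc k) n)) =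
        (\<Sum>d<q k. h (digit_reversal q (Suc k) (d + a * q k)))"
      using sum.shift_bounds_nat_ivl[of "\<lambda>n. h (digit_reversal q (Suc k) n)" 0 "a * q k" "q k"]
      by (simp add: lessThan_atLeast0 add.commute del: digit_reversal.simps)
    also have "\<dots> = (\<Sum>d<q k. h (digit_reversal q k a + ?P * d))"
      by (intro sum.cong) auto
    finally show "(\<Sum>n=a * q k..<a * q k + q k. h (digit_reversal q (Suc k) n)) = \<dots>" .
  qed simp
  also have "\<dots> = (\<Sum>d<q k. \<Sum>a<?P. h (digit_reversal q k a + ?P * d))" by (rule sum.swap)
  also have "\<dots> = (\<Sum>d<q k. \<Sum>a<?P. h (a + ?P * d))"
    using Suc.IH[of "\<lambda>x. h (x + ?P * d)" for d] by simp
  also have "\<dots> = (\<Sum>d<q k. \<Sum>n=d * ?P..<d * ?P + ?P. h n)"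
  proof (rule sum.cong)
    fix d
    show "(\<Sum>a<?P. h (a + ?P * d)) = (\<Sum>n=d * ?P..<d * ?P + ?P. h n)"
      using sum.shift_bounds_nat_ivl[of h 0 "d * ?P" ?P]
      by (simp add: lessThan_atLeast0 add.commute mult.commute)
  qed simp
  also have "\<dots> = (\<Sum>n<(\<Prod>j<Suc k. q j). h n)"
    by (simp add: sum.nat_group mult.commute)
  finally show ?case .
qed simp

text \<open>A Besicovitch limit of periodic sequences with errors fast enough to be summable. The
  approximation is assumed on positive indices only, while periodicity, encoded by
  \<open>G_mod\<close>, holds on all integers.\<close>

locale limit_periodic =
  fixes a :: "int \<Rightarrow> complex" and q :: "nat \<Rightarrow> nat" and G :: "nat \<Rightarrow> int \<Rightarrow> complex"
  assumes q_pos: "q k > 0"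
    and a_le: "norm (a m) \<le> 1"
    and G_le: "norm (G k m) \<le> 1"
    and G_mod: "G k (m mod int (q k)) = G k m"
    and G_approx: "(\<Sum>n=1..N. norm (a (int n) - G k (int n))) \<le> (1 / 2) ^ k * real N"
begin

text \<open>The periods \<open>q k\<close> need not divide one another; their products do, as the
  levels of an odometer require. The period of \<open>G k\<close> divides
  \<open>modulus (Suc k)\<close>, hence the shifted index in
  \<open>periodic_sequence\<close>.\<close>

definition modulus :: "nat \<Rightarrow> nat" where
  "modulus k = (\<Prod>j<k. q j)"

definition odometer :: "nat \<Rightarrow> real \<Rightarrow> nat" where
  "odometer k \<omega> = digit_reversal q k (nat \<lfloor>\<omega> * real (modulus k)\<rfloor>)"

definition periodic_sequence :: "nat \<Rightarrow> real \<Rightarrow> int \<Rightarrow> complex" where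
  "periodic_sequence k \<omega> = (\<lambda>m. G k (int (odometer (Suc k) \<omega>) + m))"

definition limit_sequence :: "real \<Rightarrow> int \<Rightarrow> complex" where
  "limit_sequence \<omega> = (\<lambda>m. lim (\<lambda>k. periodic_sequence k \<omega> m))"

abbreviation "\<Omega> \<equiv> unit_interval_measure"

lemma modulus_pos: "modulus k > 0"
  unfolding modulus_def using q_pos by (intro prod_pos) auto

lemma q_dvd_modulus: "j < k \<Longrightarrow> q j dvd modulus k"
  unfolding modulus_def by (intro dvd_prodI) auto

lemma G_cong:
  assumes "j < k" "m mod int (modulus k) = m' mod int (modulus k)"
  shows "G j m = G j m'"
proof -
  have "int (q j) dvd int (modulus k)" using q_dvd_modulus[OF assms(1)] by simp
  then have "m mod int (q j) = m' mod int (q j)" using assms(2) by (metis mod_mod_cancel)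
  then show ?thesis by (metis G_mod)
qed

lemma odometer_measurable [measurable]: "odometer k \<in> \<Omega> \<rightarrow>\<^sub>M count_space UNIV"
  unfolding odometer_def by measurable

lemma integral_odometer:
  fixes h :: "nat \<Rightarrow> 'b::{banach, second_countable_topology}"
  shows "(\<integral>\<omega>. h (odometer k \<omega>) \<partial>\<Omega>) = (\<Sum>i<modulus k. h i) /\<^sub>R real (modulus k)"
proof -
  have "(\<integral>\<omega>. h (odometer k \<omega>) \<partial>\<Omega>) = (\<Sum>i<modulus k. h (digit_reversal q k i)) /\<^sub>R real (modulus k)"
    unfolding odometer_def using modulus_pos
    by (rule integral_nat_floor_unit_interval[of _ "\<lambda>n. h (digit_reversal q k n)"])
  also have "(\<Sum>i<modulus k. h (digit_reversal q k i)) = (\<Sum>i<modulus k. h i)"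
    unfolding modulus_def using q_pos by (rule sum_digit_reversal)
  finally show ?thesis .
qed

text \<open>Refining the floor of \<omega> times the modulus appends a least significant digit.
  Reversal makes it the most significant one, a multiple of \<open>modulus k\<close>, so the levels
  are compatible and describe a single point.\<close>

lemma odometer_Suc_mod:
  assumes "\<omega> \<ge> 0"
  shows "odometer (Suc k) \<omega> mod modulus k = odometer k \<omega> mod modulus k"
proof -
  have "\<lfloor>\<omega> * real (modulus k)\<rfloor> = \<lfloor>\<omega> * real (modulus (Suc k)) / real_of_int (int (q k))\<rfloor>"
    using q_pos[of k] by (simp add: modulus_def)
  also have "\<dots> = \<lfloor>\<omega> * real (modulus (Suc k))\<rfloor> div int (q k)"
    by (rule floor_divide_real_eq_div) simp
  finally have "nat \<lfloor>\<omega> * real (modulus (Suc k))\<rfloor> div q k = nat \<lfloor>\<omega> * real (modulus k)\<rfloor>"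
    using assms by (simp add: nat_div_distrib)
  then show ?thesis by (simp add: odometer_def modulus_def[symmetric])
qed

text \<open>This reads two consecutive approximants at a common level, where their difference is a
  function of one uniform residue.\<close>

lemma periodic_sequence_eq:
  assumes "\<omega> \<ge> 0"
  shows "periodic_sequence k \<omega> m = G k (int (odometer (Suc (Suc k)) \<omega>) + m)"
  unfolding periodic_sequence_def
proof (rule G_cong)
  have "int (odometer (Suc k) \<omega>) mod int (modulus (Suc k)) =
      int (odometer (Suc (Suc k)) \<omega>) mod int (modulus (Suc k))"
    using odometer_Suc_mod[OF assms, of "Suc k"] by (metis zmod_int)
  then show "(int (odometer (Suc k) \<omega>) + m) mod int (modulus (Suc k)) =
      (int (odometer (Suc (Suc k)) \<omega>) + m) mod int (modulus (Suc k))"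
    by (metis mod_add_left_eq)
qed simp

lemma periodic_sequence_measurable [measurable]:
  "(\<lambda>\<omega>. periodic_sequence k \<omega> m) \<in> borel_measurable \<Omega>"
  unfolding periodic_sequence_def by measurable

lemma periodic_sequence_increment:
  "(\<integral>\<omega>. norm (periodic_sequence k \<omega> m - periodic_sequence (Suc k) \<omega> m) \<partial>\<Omega>) \<le> 2 * (1 / 2) ^ k"
proof -
  let ?Q = "modulus (Suc (Suc k))"
  define w where "w j = norm (G k j - G (Suc k) j)" for j
  have w_per: "w (j + int ?Q) = w j" for j
  proof -
    have "(j + int ?Q) mod int ?Q = j mod int ?Q" by simp
    then have "G k (j + int ?Q) = G k j" "G (Suc k) (j + int ?Q) = G (Suc k) j"
      by (auto intro: G_cong[of _ "Suc (Suc k)"])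
    then show ?thesis by (simp add: w_def)
  qed
  have "(\<integral>\<omega>. norm (periodic_sequence k \<omega> m - periodic_sequence (Suc k) \<omega> m) \<partial>\<Omega>) =
      (\<integral>\<omega>. w (int (odometer (Suc (Suc k)) \<omega>) + m) \<partial>\<Omega>)"
    by (intro Bochner_Integration.integral_cong)
      (auto simp: space_unit_interval_measure w_def periodic_sequence_eq[of _ k] periodic_sequence_def[of "Suc k"])
  also have "\<dots> = (\<Sum>i<?Q. w (int i + m)) /\<^sub>R real ?Q"
    by (rule integral_odometer[of "\<lambda>n. w (int n + m)"])
  \<comment> \<open>A sum over a full period does not depend on its start. Moving it to 1, ..., Q
    brings every coordinate \<open>m\<close>, also a negative one, into the range of
    \<open>G_approx\<close>.\<close>
  also have "(\<Sum>i<?Q. w (int i + m)) = (\<Sum>i<?Q. w (int i + 1))"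
    by (simp only: periodic_sum_shift[of w, OF w_per])
  also have "\<dots> = (\<Sum>n=1..?Q. w (int n))"
    by (rule sum.reindex_bij_witness[of _ "\<lambda>n. n - 1" Suc]) (auto simp: of_nat_diff add.commute)
  also have "\<dots> \<le> (\<Sum>n=1..?Q. norm (a (int n) - G k (int n)) + norm (a (int n) - G (Suc k) (int n)))"
    unfolding w_def by (intro sum_mono) (metis norm_minus_commute norm_triangle_le_diff norm_diff_triangle_le order_refl)
  also have "\<dots> \<le> (1 / 2) ^ k * real ?Q + (1 / 2) ^ Suc k * real ?Q"
    unfolding sum.distrib by (intro add_mono G_approx)
  also have "\<dots> \<le> 2 * (1 / 2) ^ k * real ?Q"
    by (simp add: field_simps)
  finally show ?thesis using modulus_pos[of "Suc (Suc k)"] by (simp add: divide_simps mult.commute)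
qed

text \<open>The expected increments are summable, so the sum of the increments is almost surely
  finite; countably many coordinates share one null set.\<close>

lemma AE_periodic_sequence_convergent:
  "AE \<omega> in \<Omega>. \<forall>m. convergent (\<lambda>k. periodic_sequence k \<omega> m)"
proof (subst AE_all_countable, intro allI)
  fix m
  interpret prob_space \<Omega> by (rule prob_space_unit_interval_measure)
  let ?d = "\<lambda>k \<omega>. norm (periodic_sequence k \<omega> m - periodic_sequence (Suc k) \<omega> m)"
  have norm_le: "norm (periodic_sequence k \<omega> m) \<le> 1" for k \<omega>
    by (simp add: periodic_sequence_def G_le)
  have "integrable \<Omega> (?d k)" for k
  proof (rule integrable_const_bound[where B = 2])
    show "AE \<omega> in \<Omega>. norm (?d k \<omega>) \<le> 2"
    proof (rule AE_I2)
      fix \<omega>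
      show "norm (?d k \<omega>) \<le> 2"
        using norm_triangle_ineq4[of "periodic_sequence k \<omega> m" "periodic_sequence (Suc k) \<omega> m"]
          norm_le[of k \<omega>] norm_le[of "Suc k" \<omega>] by simp
    qed
  qed measurable
  then have *: "(\<integral>\<^sup>+\<omega>. ennreal (?d k \<omega>) \<partial>\<Omega>) \<le> ennreal (2 * (1 / 2) ^ k)" for k
    by (subst nn_integral_eq_integral) (auto intro!: ennreal_leI periodic_sequence_increment)
  have "(\<integral>\<^sup>+\<omega>. (\<Sum>k. ennreal (?d k \<omega>)) \<partial>\<Omega>) = (\<Sum>k. \<integral>\<^sup>+\<omega>. ennreal (?d k \<omega>) \<partial>\<Omega>)"
    by (rule nn_integral_suminf) measurable
  also have "\<dots> \<le> (\<Sum>k. ennreal (2 * (1 / 2) ^ k))"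
    by (intro suminf_le * summableI)
  also have "\<dots> = ennreal (\<Sum>k. 2 * (1 / 2) ^ k)"
    by (intro suminf_ennreal2 summable_mult summable_geometric) auto
  also have "\<dots> < \<infinity>" by simp
  finally have "AE \<omega> in \<Omega>. (\<Sum>k. ennreal (?d k \<omega>)) \<noteq> \<infinity>"
    by (intro nn_integral_noteq_infinite) auto
  then show "AE \<omega> in \<Omega>. convergent (\<lambda>k. periodic_sequence k \<omega> m)"
  proof eventually_elim
    case (elim \<omega>)
    then have "summable (\<lambda>k. ?d k \<omega>)" by (intro summable_suminf_not_top) auto
    then have "summable (\<lambda>k. periodic_sequence k \<omega> m - periodic_sequence (Suc k) \<omega> m)"
      by (rule summable_norm_cancel)
    then have "convergent (\<lambda>n. \<Sum>k<n. periodic_sequence k \<omega> m - periodic_sequence (Suc k) \<omega> m)"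
      by (simp add: summable_iff_convergent)
    then have "convergent (\<lambda>n. periodic_sequence 0 \<omega> m - periodic_sequence n \<omega> m)"
      unfolding sum_lessThan_telescope'[of "\<lambda>k. periodic_sequence k \<omega> m"] .
    then have "convergent (\<lambda>n. periodic_sequence 0 \<omega> m - (periodic_sequence 0 \<omega> m - periodic_sequence n \<omega> m))"
      by (rule convergent_diff[OF convergent_const])
    moreover have "x - (x - y) = y" for x y :: complex by simp
    ultimately show ?case by (simp only:)
  qed
qed

lemma limit_sequence_measurable [measurable]: "limit_sequence \<in> borel_measurable \<Omega>"
  unfolding limit_sequence_def by (rule measurable_coordinatewise_then_product) measurable

lemma integral_periodic_sequence_tendsto:
  fixes \<Phi> :: "(int \<Rightarrow> complex) \<Rightarrow> complex"
  assumes \<Phi>: "continuous_on UNIV \<Phi>" and B: "\<And>x. norm (\<Phi> x) \<le> B"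
  shows "(\<lambda>k. \<integral>\<omega>. \<Phi> (periodic_sequence k \<omega>) \<partial>\<Omega>) \<longlonglongrightarrow> (\<integral>\<omega>. \<Phi> (limit_sequence \<omega>) \<partial>\<Omega>)"
proof (rule integral_dominated_convergence[where w = "\<lambda>_. B"])
  interpret prob_space \<Omega> by (rule prob_space_unit_interval_measure)
  have \<Phi>m: "\<Phi> \<in> borel_measurable borel" using \<Phi> by (rule borel_measurable_continuous_onI)
  show "(\<lambda>\<omega>. \<Phi> (limit_sequence \<omega>)) \<in> borel_measurable \<Omega>"
    using limit_sequence_measurable \<Phi>m by (rule measurable_compose)
  have "periodic_sequence k \<in> borel_measurable \<Omega>" for k
    by (rule measurable_coordinatewise_then_product) measurable
  then show "(\<lambda>\<omega>. \<Phi> (periodic_sequence k \<omega>)) \<in> borel_measurable \<Omega>" for k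
    using \<Phi>m by (rule measurable_compose)
  show "integrable \<Omega> (\<lambda>_. B)" by simp
  show "AE \<omega> in \<Omega>. norm (\<Phi> (periodic_sequence k \<omega>)) \<le> B" for k using B by simp
  show "AE \<omega> in \<Omega>. (\<lambda>k. \<Phi> (periodic_sequence k \<omega>)) \<longlonglongrightarrow> \<Phi> (limit_sequence \<omega>)"
    using AE_periodic_sequence_convergent
  proof eventually_elim
    case (elim \<omega>)
    then have "(\<lambda>k. periodic_sequence k \<omega> m) \<longlonglongrightarrow> limit_sequence \<omega> m" for m
      by (simp add: limit_sequence_def convergent_LIMSEQ_iff)
    then have "limitin (product_topology (\<lambda>_. euclidean) UNIV) (\<lambda>k. periodic_sequence k \<omega>)
        (limit_sequence \<omega>) sequentially"
      by (simp add: limitin_componentwise)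
    then have "(\<lambda>k. periodic_sequence k \<omega>) \<longlonglongrightarrow> limit_sequence \<omega>"
      by (simp add: euclidean_product_topology)
    then show ?case by (intro continuous_on_tendsto_compose[OF \<Phi>]) auto
  qed
qed

section \<open>Averages along the orbit\<close>

lemma average_shift_G_tendsto:
  fixes \<Phi> :: "(int \<Rightarrow> complex) \<Rightarrow> complex"
  shows "(\<lambda>N. (\<Sum>n=1..N. \<Phi> (shift_pow (int n) (G k))) / of_nat N)
     \<longlonglongrightarrow> (\<integral>\<omega>. \<Phi> (periodic_sequence k \<omega>) \<partial>\<Omega>)"
proof -
  let ?Q = "modulus (Suc k)"
  define H where "H n = \<Phi> (shift_pow (int n) (G k))" for n
  have "H (n + ?Q) = H n" for n
  proof -
    have "G k (m + int (n + ?Q)) = G k (m + int n)" for m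
      by (rule G_cong[of _ "Suc k"]) (auto simp flip: add.assoc)
    then show ?thesis by (simp add: H_def shift_pow_def)
  qed
  from periodic_average_tendsto[of ?Q H, OF modulus_pos this]
  have "(\<lambda>N. (\<Sum>n=1..N. H n) / of_nat N) \<longlonglongrightarrow> (\<Sum>i<?Q. H i) / of_nat ?Q" .
  moreover have "(\<Sum>i<?Q. H i) / of_nat ?Q = (\<integral>\<omega>. H (odometer (Suc k) \<omega>) \<partial>\<Omega>)"
    by (subst integral_odometer) (simp add: scaleR_conv_of_real divide_inverse mult.commute)
  moreover have "H (odometer (Suc k) \<omega>) = \<Phi> (periodic_sequence k \<omega>)" for \<omega>
    by (simp add: H_def shift_pow_def periodic_sequence_def add.commute)
  ultimately show ?thesis by (simp add: H_def)
qed

text \<open>A shift by \<open>m\<close> moves at most |m| indices to nonpositive positions, where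
  each term is at most 2, and overshoots N by at most |m|.\<close>

lemma shifted_approx:
  "(\<Sum>n=1..N. norm (a (m + int n) - G k (m + int n))) \<le> (1 / 2) ^ k * (real N + \<bar>m\<bar>) + 2 * \<bar>m\<bar>"
proof -
  define d where "d j = norm (a j - G k j)" for j
  have d: "0 \<le> d j" "d j \<le> 2" for j
    using norm_triangle_ineq4[of "a j" "G k j"] a_le[of j] G_le[of k j] by (auto simp: d_def)
  let ?P = "{n\<in>{1..N}. m + int n > 0}" and ?R = "{n\<in>{1..N}. \<not> m + int n > 0}"
  have "(\<Sum>n=1..N. d (m + int n)) = (\<Sum>n\<in>?P. d (m + int n)) + (\<Sum>n\<in>?R. d (m + int n))"
    by (subst sum.union_disjoint[symmetric]) (auto intro: sum.cong)
  also have "(\<Sum>n\<in>?P. d (m + int n)) = (\<Sum>j\<in>(\<lambda>n. nat (m + int n)) ` ?P. d (int j))"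
    by (subst sum.reindex) (auto intro!: inj_onI)
  also have "\<dots> \<le> (\<Sum>j=1..N + nat \<bar>m\<bar>. d (int j))"
    using d(1) by (intro sum_mono2) auto
  also have "\<dots> \<le> (1 / 2) ^ k * real (N + nat \<bar>m\<bar>)"
    unfolding d_def by (rule G_approx)
  also have "(\<Sum>n\<in>?R. d (m + int n)) \<le> (\<Sum>n\<in>?R. 2)" using d(2) by (intro sum_mono)
  also have "\<dots> = 2 * real (card ?R)" by simp
  also have "card ?R \<le> card {1..nat \<bar>m\<bar>}" by (intro card_mono) auto
  finally show ?thesis by (simp add: d_def)
qed

lemma eventually_shifted_approx:
  "\<forall>\<^sub>F N in sequentially. (\<Sum>n=1..N. norm (a (m + int n) - G k (m + int n))) \<le> 2 * (1 / 2) ^ k * real N"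
proof -
  have "filterlim (\<lambda>N. (1 / 2) ^ k * real N) at_top sequentially"
    by (intro filterlim_tendsto_pos_mult_at_top[OF tendsto_const _ filterlim_real_sequentially]) simp
  then have "\<forall>\<^sub>F N in sequentially. (1 / 2) ^ k * \<bar>m\<bar> + 2 * \<bar>m\<bar> \<le> (1 / 2) ^ k * real N"
    by (simp add: filterlim_at_top)
  then show ?thesis
  proof eventually_elim
    case (elim N)
    then show ?case using shifted_approx[of m k N] by (simp add: distrib_left)
  qed
qed

text \<open>With \<open>k\<close> fixed first, four errors of e/4 arise: the modulus of continuity,
  the mean distance of \<open>a\<close> to \<open>G k\<close> on the coordinates in
  \<open>J\<close>, the periodic average, and the distance of its limit from the final
  integral.\<close>

lemma average_shift_tendsto:
  fixes \<Phi> :: "(int \<Rightarrow> complex) \<Rightarrow> complex"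
  assumes \<Phi>: "continuous_on UNIV \<Phi>" and B: "\<And>x. norm (\<Phi> x) \<le> B"
  shows "(\<lambda>N. (\<Sum>n=1..N. \<Phi> (shift_pow (int n) a)) / of_nat N) \<longlonglongrightarrow> (\<integral>\<omega>. \<Phi> (limit_sequence \<omega>) \<partial>\<Omega>)"
proof (rule tendstoI)
  fix e :: real assume e: "e > 0"
  let ?L = "\<integral>\<omega>. \<Phi> (limit_sequence \<omega>) \<partial>\<Omega>" and ?L' = "\<lambda>k. \<integral>\<omega>. \<Phi> (periodic_sequence k \<omega>) \<partial>\<Omega>"
  obtain J C where J: "finite J" and C: "C \<ge> 0" and modulus:
    "\<And>x y. x \<in> disc_sequences \<Longrightarrow> y \<in> disc_sequences \<Longrightarrow>
       norm (\<Phi> x - \<Phi> y) \<le> e / 4 + C * (\<Sum>m\<in>J. norm (x m - y m))"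
    using continuous_on_disc_sequences_modulus[of \<Phi> "e / 4"] e continuous_on_subset[OF \<Phi>] by auto
  have "(\<lambda>k. C * (real (card J) * (2 * (1 / 2) ^ k))) \<longlonglongrightarrow> C * (real (card J) * (2 * 0))"
    by (intro tendsto_mult tendsto_const LIMSEQ_power_zero) simp
  then have "\<forall>\<^sub>F k in sequentially. C * (real (card J) * (2 * (1 / 2) ^ k)) < e / 4"
    using e by (intro order_tendstoD) auto
  moreover have "\<forall>\<^sub>F k in sequentially. dist (?L' k) ?L < e / 4"
    using integral_periodic_sequence_tendsto[OF assms] e by (intro tendstoD) auto
  ultimately have "\<forall>\<^sub>F k in sequentially. C * (real (card J) * (2 * (1 / 2) ^ k)) < e / 4 \<and> dist (?L' k) ?L < e / 4"
    by (rule eventually_conj)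
  then obtain k where k: "C * (real (card J) * (2 * (1 / 2) ^ k)) < e / 4" "dist (?L' k) ?L < e / 4"
    by (auto simp: eventually_sequentially)
  have "\<forall>\<^sub>F N in sequentially. dist ((\<Sum>n=1..N. \<Phi> (shift_pow (int n) (G k))) / of_nat N) (?L' k) < e / 4"
    using average_shift_G_tendsto[of \<Phi> k] e by (intro tendstoD) auto
  moreover have "\<forall>\<^sub>F N in sequentially. \<forall>m\<in>J.
      (\<Sum>n=1..N. norm (a (m + int n) - G k (m + int n))) \<le> 2 * (1 / 2) ^ k * real N"
    using J eventually_shifted_approx by (intro eventually_ball_finite) auto
  ultimately show "\<forall>\<^sub>F N in sequentially. dist ((\<Sum>n=1..N. \<Phi> (shift_pow (int n) a)) / of_nat N) ?L < e"
    using eventually_gt_at_top[of 0]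
  proof eventually_elim
    case (elim N)
    let ?A = "(\<Sum>n=1..N. \<Phi> (shift_pow (int n) a)) / of_nat N"
      and ?A' = "(\<Sum>n=1..N. \<Phi> (shift_pow (int n) (G k))) / of_nat N"
    have "norm ((\<Sum>n=1..N. \<Phi> (shift_pow (int n) a)) - (\<Sum>n=1..N. \<Phi> (shift_pow (int n) (G k)))) \<le>
        (\<Sum>n=1..N. norm (\<Phi> (shift_pow (int n) a) - \<Phi> (shift_pow (int n) (G k))))"
      unfolding sum_subtractf[symmetric] by (rule norm_sum)
    also have "\<dots> \<le> (\<Sum>n=1..N. e / 4 + C * (\<Sum>m\<in>J. norm (a (m + int n) - G k (m + int n))))"
    proof (rule sum_mono)
      fix n
      have "shift_pow (int n) a \<in> disc_sequences" "shift_pow (int n) (G k) \<in> disc_sequences"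
        using a_le G_le by (auto simp: disc_sequences_def shift_pow_def)
      from modulus[OF this]
      show "norm (\<Phi> (shift_pow (int n) a) - \<Phi> (shift_pow (int n) (G k))) \<le>
          e / 4 + C * (\<Sum>m\<in>J. norm (a (m + int n) - G k (m + int n)))"
        by (simp add: shift_pow_def)
    qed
    also have "\<dots> = real N * (e / 4) + C * (\<Sum>m\<in>J. \<Sum>n=1..N. norm (a (m + int n) - G k (m + int n)))"
      by (simp add: sum.distrib sum_distrib_left[symmetric] sum.swap[of _ J])
    also have "\<dots> \<le> real N * (e / 4) + C * (\<Sum>m\<in>J. 2 * (1 / 2) ^ k * real N)"
      using elim(2) C by (intro add_left_mono mult_left_mono sum_mono) auto
    also have "\<dots> = real N * (e / 4 + C * (real (card J) * (2 * (1 / 2) ^ k)))"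
      by (simp add: algebra_simps)
    also have "\<dots> \<le> real N * (e / 4 + e / 4)"
      using k(1) by (intro mult_left_mono add_left_mono) auto
    finally have "norm (?A - ?A') \<le> e / 2"
      using elim(3) by (simp add: norm_divide divide_simps mult.commute flip: diff_divide_distrib)
    then have "dist ?A ?A' \<le> e / 2" by (simp add: dist_norm)
    then show ?case
      using elim(1) k(2) dist_triangle[of ?A ?L ?A'] dist_triangle[of ?A' ?L "?L' k"] by linarith
  qed
qed

end

section \<open>Generic points\<close>

text \<open>Off the closed set the distance is positive, so these continuous functions decrease to
  its indicator. The empty set is excluded because \<open>infdist\<close> to it is 0 by
  convention.\<close>

lemma tendsto_integral_closed_set_indicator:
  fixes C :: "'a::metric_space set"
  assumes "prob_space M" and sets: "sets M = sets (restrict_space borel X)"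
    and C: "closed C" "C \<noteq> {}"
  shows "(\<lambda>n. \<integral>x. complex_of_real (max 0 (1 - real n * infdist x C)) \<partial>M) \<longlonglongrightarrow>
    complex_of_real (measure M (C \<inter> X))"
proof -
  interpret prob_space M by fact
  have M: "borel_measurable M = borel_measurable (restrict_space borel X)"
    using sets by (rule measurable_cong_sets) simp
  have space: "space M = X" using sets_eq_imp_space_eq[OF sets] by (simp add: space_restrict_space)
  have CX: "C \<inter> X \<in> sets M" unfolding sets using C by (auto simp: sets_restrict_space)
  have "(\<lambda>n. \<integral>x. complex_of_real (max 0 (1 - real n * infdist x C)) \<partial>M) \<longlonglongrightarrow>
      (\<integral>x. complex_of_real (indicator (C \<inter> X) x) \<partial>M)"
  proof (rule integral_dominated_convergence[where w = "\<lambda>_. 1"])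
    show "(\<lambda>x. complex_of_real (indicator (C \<inter> X) x)) \<in> borel_measurable M"
      using CX by measurable
    show "(\<lambda>x. complex_of_real (max 0 (1 - real n * infdist x C))) \<in> borel_measurable M" for n
      unfolding M
      by (intro borel_measurable_continuous_on_restrict continuous_intros)
    show "AE x in M. norm (complex_of_real (max 0 (1 - real n * infdist x C))) \<le> 1" for n
      by (intro AE_I2) (simp add: infdist_nonneg)
    show "AE x in M. (\<lambda>n. complex_of_real (max 0 (1 - real n * infdist x C))) \<longlonglongrightarrow>
        complex_of_real (indicator (C \<inter> X) x)"
    proof (rule AE_I2)
      fix x assume x: "x \<in> space M"
      show "(\<lambda>n. complex_of_real (max 0 (1 - real n * infdist x C))) \<longlonglongrightarrow>
        complex_of_real (indicator (C \<inter> X) x)"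
      proof (cases "x \<in> C")
        case True
        then show ?thesis using x by (simp add: space)
      next
        case False
        then have "infdist x C > 0"
          using C infdist_nonneg[of x C] by (metis in_closed_iff_infdist_zero order_le_less)
        then obtain N where N: "1 < real N * infdist x C" using reals_Archimedean3 by blast
        have "max 0 (1 - real n * infdist x C) = 0" if "n \<ge> N" for n
        proof -
          have "real N * infdist x C \<le> real n * infdist x C"
            using that infdist_nonneg by (intro mult_right_mono) auto
          then show ?thesis using N by simp
        qed
        then have "\<forall>\<^sub>F n in sequentially. complex_of_real (max 0 (1 - real n * infdist x C)) = 0"
          unfolding eventually_sequentially by (metis of_real_0)
        then show ?thesis using False by (simp add: tendsto_eventually)
      qed
    qed
  qed simp
  also have "(\<integral>x. complex_of_real (indicator (C \<inter> X) x) \<partial>M) = complex_of_real (measure M (C \<inter> X))"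
    using CX space by (simp add: Int_absorb2 sets.sets_into_space)
  finally show ?thesis .
qed

text \<open>Closed sets form an intersection-stable generator of the Borel sets. The measures live
  on a subspace, so their images in the whole space are compared.\<close>

lemma prob_measures_on_eqI:
  fixes \<mu> \<nu> :: "'a::metric_space measure"
  assumes \<mu>: "\<mu> \<in> prob_measures_on X" and \<nu>: "\<nu> \<in> prob_measures_on X"
    and eq: "\<And>g :: 'a \<Rightarrow> complex. continuous_on X g \<Longrightarrow> (\<integral>x. g x \<partial>\<mu>) = (\<integral>x. g x \<partial>\<nu>)"
  shows "\<mu> = \<nu>"
proof -
  have ps: "prob_space \<mu>" "prob_space \<nu>" "sets \<mu> = sets (restrict_space borel X)"
    "sets \<nu> = sets (restrict_space borel X)"
    using \<mu> \<nu> by (auto simp: prob_measures_on_def)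
  have space: "space \<mu> = X" "space \<nu> = X"
    using sets_eq_imp_space_eq[OF ps(3)] sets_eq_imp_space_eq[OF ps(4)]
    by (auto simp: space_restrict_space)
  have id: "(\<lambda>x. x) \<in> measurable M borel"
    if "sets M = sets (restrict_space borel X)" for M :: "'a measure"
    by (subst measurable_cong_sets[OF that refl]) (rule measurable_restrict_space1, simp)
  note id = id[OF ps(3)] id[OF ps(4)]
  have closed_eq: "emeasure \<mu> (C \<inter> X) = emeasure \<nu> (C \<inter> X)" if C: "closed C" for C
  proof (cases "C = {}")
    case False
    have "(\<integral>x. complex_of_real (max 0 (1 - real n * infdist x C)) \<partial>\<mu>) =
        (\<integral>x. complex_of_real (max 0 (1 - real n * infdist x C)) \<partial>\<nu>)" for n
      by (intro eq continuous_intros)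
    note tendsto_integral_closed_set_indicator[OF ps(1,3) C False, unfolded this]
    from LIMSEQ_unique[OF this tendsto_integral_closed_set_indicator[OF ps(2,4) C False]]
    have "measure \<mu> (C \<inter> X) = measure \<nu> (C \<inter> X)" by simp
    then show ?thesis
      using ps(1,2) by (simp add: finite_measure.emeasure_eq_measure prob_space.finite_measure)
  qed simp
  have "distr \<mu> borel (\<lambda>x. x) = distr \<nu> borel (\<lambda>x. x)"
  proof (rule measure_eqI_generator_eq[where E = "Collect closed" and \<Omega> = UNIV and A = "\<lambda>_. UNIV"])
    show "emeasure (distr \<mu> borel (\<lambda>x. x)) C = emeasure (distr \<nu> borel (\<lambda>x. x)) C"
      if "C \<in> Collect closed" for C
      using that id closed_eq by (simp add: emeasure_distr space)
    show "emeasure (distr \<mu> borel (\<lambda>x. x)) UNIV \<noteq> \<infinity>" for i :: nat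
      using id ps(1) by (simp add: emeasure_distr finite_measure.emeasure_finite prob_space.finite_measure)
  qed (auto simp: Int_stable_def borel_eq_closed)
  note distr_eq = this
  show ?thesis
  proof (rule measure_eqI)
    fix A assume "A \<in> sets \<mu>"
    then obtain B where B: "B \<in> sets borel" "A = B \<inter> X"
      using ps(3) by (auto simp: sets_restrict_space)
    have "emeasure (distr \<mu> borel (\<lambda>x. x)) B = emeasure (distr \<nu> borel (\<lambda>x. x)) B"
      by (simp only: distr_eq)
    then show "emeasure \<mu> A = emeasure \<nu> A"
      using id B by (simp add: emeasure_distr space)
  qed (simp add: ps)
qed

lemma generic_point_unique_furstenberg_system:
  assumes "generic_point f"
  shows "\<exists>!\<nu>. furstenberg_system f \<nu>"
proof -
  obtain \<nu> where \<nu>: "\<nu> \<in> prob_measures_on (orbit_closure f)"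
    "weak_star_tendsto (orbit_closure f) (empirical_measure f) \<nu>"
    using assms by (auto simp: generic_point_def)
  show ?thesis
  proof (rule ex1I)
    show "furstenberg_system f \<nu>"
      unfolding furstenberg_system_def using \<nu> filterlim_ident by blast
  next
    fix \<mu> assume \<mu>: "furstenberg_system f \<mu>"
    then obtain N where \<mu>': "\<mu> \<in> prob_measures_on (orbit_closure f)"
      and N: "filterlim N at_top sequentially"
      "weak_star_tendsto (orbit_closure f) (\<lambda>k. empirical_measure f (N k)) \<mu>"
      by (auto simp: furstenberg_system_def)
    show "\<mu> = \<nu>"
    proof (rule prob_measures_on_eqI[OF \<mu>' \<nu>(1)])
      fix g :: "(int \<Rightarrow> complex) \<Rightarrow> complex" assume g: "continuous_on (orbit_closure f) g"
      have "(\<lambda>k. \<integral>x. g x \<partial>empirical_measure f (N k)) \<longlonglongrightarrow> (\<integral>x. g x \<partial>\<nu>)"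
        by (rule filterlim_compose[OF _ N(1)]) (use \<nu>(2) g in \<open>simp add: weak_star_tendsto_def\<close>)
      moreover have "(\<lambda>k. \<integral>x. g x \<partial>empirical_measure f (N k)) \<longlonglongrightarrow> (\<integral>x. g x \<partial>\<mu>)"
        using N(2) g unfolding weak_star_tendsto_def by blast
      ultimately show "(\<integral>x. g x \<partial>\<mu>) = (\<integral>x. g x \<partial>\<nu>)" by (rule LIMSEQ_unique[symmetric])
    qed
  qed
qed

text \<open>The distance to the orbit closure vanishes along the orbit, hence so does its
  expectation under the limit law. Truncation at 1 makes it bounded, as the averaging result
  requires.\<close>

lemma (in limit_periodic) AE_limit_sequence_orbit_closure:
  "AE \<omega> in \<Omega>. limit_sequence \<omega> \<in> closure (range (\<lambda>n. shift_pow n a))"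
proof -
  interpret prob_space \<Omega> by (rule prob_space_unit_interval_measure)
  define X where "X = closure (range (\<lambda>n. shift_pow n a))"
  have X: "closed X" "X \<noteq> {}" by (auto simp: X_def)
  define d where "d x = min 1 (infdist x X)" for x
  have d: "0 \<le> d x" "d x \<le> 1" for x by (auto simp: d_def infdist_nonneg)
  have cont: "continuous_on UNIV d" unfolding d_def by (intro continuous_intros)
  have "d (shift_pow (int n) a) = 0" for n
  proof -
    have "shift_pow (int n) a \<in> X" unfolding X_def using closure_subset by fastforce
    then show ?thesis by (simp add: d_def)
  qed
  then have "(\<lambda>N. 0) \<longlonglongrightarrow> (\<integral>\<omega>. complex_of_real (d (limit_sequence \<omega>)) \<partial>\<Omega>)"
    using average_shift_tendsto[of "\<lambda>x. complex_of_real (d x)" 1] d cont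
    by (simp add: continuous_on_of_real)
  then have 0: "(\<integral>\<omega>. d (limit_sequence \<omega>) \<partial>\<Omega>) = 0"
    by (simp add: LIMSEQ_const_iff)
  have "(\<lambda>\<omega>. d (limit_sequence \<omega>)) \<in> borel_measurable \<Omega>"
    using limit_sequence_measurable borel_measurable_continuous_onI[OF cont] by (rule measurable_compose)
  then have "integrable \<Omega> (\<lambda>\<omega>. d (limit_sequence \<omega>))"
    using d by (intro integrable_const_bound[where B = 1]) auto
  then have "AE \<omega> in \<Omega>. d (limit_sequence \<omega>) = 0"
    using integral_nonneg_eq_0_iff_AE d(1) 0 by blast
  then show ?thesis
  proof eventually_elim
    case (elim \<omega>)
    then have "infdist (limit_sequence \<omega>) X = 0" by (auto simp: d_def min_def split: if_splits)
    then show ?case using X in_closed_iff_infdist_zero unfolding X_def[symmetric] by blast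
  qed
qed

lemma (in limit_periodic) generic_pointI:
  assumes f: "a = extend_by_zero f"
  shows "generic_point f"
proof -
  interpret prob_space \<Omega> by (rule prob_space_unit_interval_measure)
  define X where "X = orbit_closure f"
  have X_closed: "closed X" by (simp add: X_def orbit_closure_def)
  have mem: "shift_pow n a \<in> X" for n
    unfolding X_def orbit_closure_def f using closure_subset by fastforce
  have "X \<subseteq> disc_sequences"
    unfolding X_def orbit_closure_def f[symmetric] using a_le
    by (intro closure_minimal compact_imp_closed compact_disc_sequences)
      (auto simp: disc_sequences_def shift_pow_def)
  then have X_compact: "compact X"
    using X_closed compact_disc_sequences by (metis compact_Int_closed inf.absorb_iff2)
  have AE_X: "AE \<omega> in \<Omega>. limit_sequence \<omega> \<in> X"
    using AE_limit_sequence_orbit_closure by (simp add: X_def orbit_closure_def f)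
  \<comment> \<open>A change on a null set: a measurable map into the subspace must take values in
    \<open>X\<close> everywhere. The default \<open>a\<close> is its own shift by 0.\<close>
  define Y where "Y \<omega> = (if limit_sequence \<omega> \<in> X then limit_sequence \<omega> else a)" for \<omega>
  have Y_mem: "Y \<omega> \<in> X" for \<omega> using mem[of 0] by (simp add: Y_def shift_pow_0)
  have "Y \<in> borel_measurable \<Omega>"
    unfolding Y_def
  proof (rule measurable_If[OF limit_sequence_measurable])
    show "{\<omega> \<in> space \<Omega>. limit_sequence \<omega> \<in> X} \<in> sets \<Omega>"
      using measurable_sets[OF limit_sequence_measurable borel_closed[OF X_closed]]
      by (simp add: vimage_def Int_def conj_commute)
  qed simp
  then have Y: "Y \<in> \<Omega> \<rightarrow>\<^sub>M restrict_space borel X"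
    using Y_mem by (intro measurable_restrict_space2) auto
  define \<nu> where "\<nu> = distr \<Omega> (restrict_space borel X) Y"
  have "\<nu> \<in> prob_measures_on X"
    unfolding prob_measures_on_def \<nu>_def using prob_space_distr[OF Y] by simp
  moreover have "weak_star_tendsto X (empirical_measure f) \<nu>"
    unfolding weak_star_tendsto_def
  proof (intro allI impI)
    fix g :: "(int \<Rightarrow> complex) \<Rightarrow> complex" assume g: "continuous_on X g"
    have "bounded (g ` X)" by (intro compact_imp_bounded compact_continuous_image g X_compact)
    then obtain B where B: "B > 0" "\<And>x. x \<in> X \<Longrightarrow> norm (g x) \<le> B"
      unfolding bounded_pos by auto
    \<comment> \<open>The averages are controlled for bounded continuous functions on the whole
      product space, so \<open>g\<close> is extended from the closed set \<open>X\<close> with the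
      same bound.\<close>
    obtain \<Phi> where \<Phi>: "continuous_on UNIV \<Phi>" "\<And>x. x \<in> X \<Longrightarrow> \<Phi> x = g x" "\<And>x. norm (\<Phi> x) \<le> B"
      using Tietze[of X g UNIV B] g X_closed B by auto
    have "(\<integral>x. g x \<partial>\<nu>) = (\<integral>\<omega>. g (Y \<omega>) \<partial>\<Omega>)"
      unfolding \<nu>_def using Y borel_measurable_continuous_on_restrict[OF g] by (rule integral_distr)
    also have "\<dots> = (\<integral>\<omega>. \<Phi> (Y \<omega>) \<partial>\<Omega>)" using Y_mem \<Phi>(2) by simp
    also have "\<dots> = (\<integral>\<omega>. \<Phi> (limit_sequence \<omega>) \<partial>\<Omega>)"
    proof (rule integral_cong_AE)
      have m: "\<Phi> \<in> borel_measurable borel" using \<Phi>(1) by (rule borel_measurable_continuous_onI)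
      show "(\<lambda>\<omega>. \<Phi> (Y \<omega>)) \<in> borel_measurable \<Omega>" "(\<lambda>\<omega>. \<Phi> (limit_sequence \<omega>)) \<in> borel_measurable \<Omega>"
        using measurable_compose[OF \<open>Y \<in> borel_measurable \<Omega>\<close> m]
          measurable_compose[OF limit_sequence_measurable m] by auto
      show "AE \<omega> in \<Omega>. \<Phi> (Y \<omega>) = \<Phi> (limit_sequence \<omega>)"
        using AE_X by eventually_elim (simp add: Y_def)
    qed
    finally have lim: "(\<integral>x. g x \<partial>\<nu>) = (\<integral>\<omega>. \<Phi> (limit_sequence \<omega>) \<partial>\<Omega>)" .
    have "(\<integral>x. g x \<partial>empirical_measure f N) = (\<Sum>n=1..N. \<Phi> (shift_pow (int n) a)) / of_nat N" for N
      using g mem \<Phi>(2) by (simp add: integral_empirical_measure X_def f)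
    then show "(\<lambda>N. \<integral>x. g x \<partial>empirical_measure f N) \<longlonglongrightarrow> (\<integral>x. g x \<partial>\<nu>)"
      unfolding lim using average_shift_tendsto[OF \<Phi>(1,3)] by simp
  qed
  ultimately show ?thesis unfolding generic_point_def X_def by blast
qed

lemma periodic_approximation_imp_generic_point:
  fixes f :: "nat \<Rightarrow> complex"
  assumes le1: "\<And>n. n > 0 \<Longrightarrow> norm (f n) \<le> 1"
    and approx: "\<And>e. e > 0 \<Longrightarrow> \<exists>Q>0. \<exists>g. (\<forall>n. g (n + Q) = g n) \<and> (\<forall>n. norm (g n) \<le> 1) \<and>
     (\<forall>N. (\<Sum>n=1..N. norm (f n - g n)) \<le> e * real N)"
  shows "generic_point f"
proof -
  have "\<forall>k::nat. \<exists>Q g. Q > 0 \<and> (\<forall>n. g (n + Q) = g n) \<and> (\<forall>n. norm (g n) \<le> 1) \<and>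
     (\<forall>N. (\<Sum>n=1..N. norm (f n - g n)) \<le> (1 / 2) ^ k * real N)"
  proof
    fix k :: nat
    show "\<exists>Q g. Q > 0 \<and> (\<forall>n. g (n + Q) = g n) \<and> (\<forall>n. norm (g n) \<le> 1) \<and>
     (\<forall>N. (\<Sum>n=1..N. norm (f n - g n)) \<le> (1 / 2) ^ k * real N)"
      using approx[of "(1 / 2) ^ k"] by auto
  qed
  then obtain Q g where Q: "\<And>k::nat. Q k > 0" and per: "\<And>k n. g k (n + Q k) = g k n"
    and g1: "\<And>k n. norm (g k n) \<le> 1"
    and g: "\<And>k N. (\<Sum>n=1..N. norm (f n - g k n)) \<le> (1 / 2) ^ k * real N"
    by metis
  have "g k (n + j * Q k) = g k n" for k n j
  proof (induction j)
    case (Suc j)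
    then show ?case using per[of k "n + j * Q k"] by (simp add: add_ac)
  qed simp
  then have g_mod: "g k (n mod Q k) = g k n" for k n
    by (metis mod_mult_div_eq mult.commute)
  \<comment> \<open>Periodic continuation to the negative integers, where
    \<open>extend_by_zero f\<close> is 0 and no approximation is claimed.\<close>
  define G where "G k m = g k (nat (m mod int (Q k)))" for k m
  have G_nat: "G k (int n) = g k n" for k n by (simp add: G_def g_mod flip: zmod_int)
  have "limit_periodic (extend_by_zero f) Q G"
  proof
    show "norm (extend_by_zero f m) \<le> 1" for m using le1 by (simp add: extend_by_zero_def)
    show "(\<Sum>n=1..N. norm (extend_by_zero f (int n) - G k (int n))) \<le> (1 / 2) ^ k * real N" for N k
      using g[where k = k and N = N] by (simp add: G_nat extend_by_zero_def)
  qed (auto simp: Q g1 G_def)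
  then show ?thesis by (rule limit_periodic.generic_pointI) simp
qed

theorem corollary2p5:
  fixes f :: "nat \<Rightarrow> complex"
  assumes "f \<in> multiplicative_unit_class"
    and "\<forall>n>0. f n \<in> \<real>"
    and "pretentious f"
  shows "(\<exists>!\<nu>. furstenberg_system f \<nu>) \<and> generic_point f"
proof -
  have le1: "norm (f n) \<le> 1" if "n > 0" for n
    using assms(1) that by (simp add: multiplicative_unit_class_def)
  obtain q chi where "dirichlet_character q chi"
    "(\<lambda>p. norm (f p - chi p) / real p) summable_on {p. prime p}"
    using real_pretentious_absolutely[OF assms(3)] assms(2) le1 by blast
  note approx = multiplicative_periodic_approximation[OF this(1) assms(1) this(2)]
  have "generic_point f"
    by (rule periodic_approximation_imp_generic_point[OF le1 approx])
  then show ?thesis using generic_point_unique_furstenberg_system by blast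
qed

end
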